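(* Let $T$ be a tree on $n$ vertices with independence number $\alpha$. Then $$H(T)\le \frac{1}{24}\left(3n^2+2\alpha n+\alpha^2-9\alpha+19n-22\right),$$ with equality if and only if $T\cong A_{n,\alpha}$.
   Context: The Harary index of a connected graph $G$ is $H(G)=\sum_{\{x,y\}\subseteq V(G),\,x\ne y}\frac{1}{d(x,y)}$, $d$ the shortest-path distance. The independence number is the maximum size of a set of pairwise non-adjacent vertices. For $\frac{n-1}{2}\le m\le n-1$, the spur $A_{n,m}$ is the tree obtained from the star $S_{m+1}$ by adding a pendent edge to each of $n-m-1$ of its pendent vertices.
   Formalization: The tree is assumed to have n ≥ 2 vertices: for the one-vertex tree α = 1 and H(T) = 0, while the right-hand side is −1/4 and the spur A_{1,1} is undefined. *)

theory Defs
  imports Complex_Main "Graph_Theory.Graph_Theory"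
begin

text \<open>
  Finite simple graphs are symmetric digraphs in the sense of the locale \<^locale>\<open>graph\<close>, each
  undirected edge being a pair of opposite arcs. The library's \<^const>\<open>tree\<close> is not the notion of
  a tree for such graphs, because \<^const>\<open>pre_digraph.cycle\<close> counts the closed walk \<open>a, b, a\<close>
  along a single edge as a cycle. In a simple graph the cycles are exactly those of length at
  least 3.
\<close>

definition graph_tree :: "('a, 'b) pre_digraph \<Rightarrow> bool" where
  "graph_tree G \<longleftrightarrow>
     graph G \<and> connected G \<and> \<not> (\<exists>p. pre_digraph.cycle G p \<and> length p \<ge> 3)"

definition graph_dist :: "('a, 'b) pre_digraph \<Rightarrow> 'a \<Rightarrow> 'a \<Rightarrow> real" where
  "graph_dist G u v = real_of_ereal (wf_digraph.\<mu> G (\<lambda>_. 1) u v)"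

text \<open>The sum over ordered pairs counts each unordered pair twice.\<close>

definition harary_index :: "('a, 'b) pre_digraph \<Rightarrow> real" where
  "harary_index G = (\<Sum>u\<in>verts G. \<Sum>v\<in>verts G - {u}. 1 / graph_dist G u v) / 2"

definition independent_set :: "('a, 'b) pre_digraph \<Rightarrow> 'a set \<Rightarrow> bool" where
  "independent_set G S \<longleftrightarrow> S \<subseteq> verts G \<and> (\<forall>u\<in>S. \<forall>v\<in>S. \<not> u \<rightarrow>\<^bsub>G\<^esub> v)"

definition independence_number :: "('a, 'b) pre_digraph \<Rightarrow> nat" where
  "independence_number G = Max (card ` {S. independent_set G S})"

text \<open>
  The spur \<open>A\<^sub>n\<^sub>,\<^sub>m\<close>, meaningful for \<open>(n - 1) / 2 \<le> m \<le> n - 1\<close>: the star has centre 0 and pendent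
  vertices \<open>1, \<dots>, m\<close>; for \<open>1 \<le> i \<le> n - m - 1\<close> the vertex \<open>m + i\<close> is the new end of the pendent
  edge added at \<open>i\<close>.
\<close>

definition spur :: "nat \<Rightarrow> nat \<Rightarrow> nat pair_pre_digraph" where
  "spur n m =
     (let E = {(0, i) | i. 1 \<le> i \<and> i \<le> m} \<union> {(i, m + i) | i. 1 \<le> i \<and> i \<le> n - m - 1}
      in \<lparr>pverts = {..<n}, parcs = E \<union> E\<inverse>\<rparr>)"

end

theory Submission
  imports Defs
begin

text \<open>
  By induction on \<open>n\<close>, deleting leaves at the end of a longest path. If two leaves \<open>v, v'\<close> hang on the
  same vertex \<open>w\<close>, deleting \<open>v\<close> lowers \<open>\<alpha>\<close> by one, and the reciprocal distances from \<open>v\<close> sum to at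
  most \<open>1 + (deg w - 1) / 2 + (n - 1 - deg w) / 3\<close>. Otherwise a longest path ends in a leaf \<open>v\<close> whose
  neighbour \<open>w\<close> has just one other neighbour \<open>x\<close>; deleting both \<open>v\<close> and \<open>w\<close> again lowers \<open>\<alpha>\<close> by one,
  and the loss is bounded likewise in terms of \<open>deg x\<close>. Since neighbours of a vertex are independent,
  all degrees are at most \<open>\<alpha>\<close>, and in both cases this yields exactly the increment of the claimed bound.
  Equality forces a vertex of degree \<open>\<alpha>\<close> from which every vertex is at distance at most 2. By
  maximality of \<open>\<alpha>\<close> each of its neighbours then has at most one further neighbour, so the tree is a
  spur. Conversely, peeling off the legs of a spur makes the same estimates equalities.
\<close>

section \<open>Tree metrics\<close>

definition nbrs :: "'a set \<Rightarrow> ('a \<Rightarrow> 'a \<Rightarrow> nat) \<Rightarrow> 'a \<Rightarrow> 'a set" where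
  "nbrs V d x = {y\<in>V. d x y = 1}"

definition harary :: "'a set \<Rightarrow> ('a \<Rightarrow> 'a \<Rightarrow> nat) \<Rightarrow> real" where
  "harary V d = (\<Sum>u\<in>V. \<Sum>v\<in>V - {u}. 1 / real (d u v)) / 2"

definition indep :: "'a set \<Rightarrow> ('a \<Rightarrow> 'a \<Rightarrow> nat) \<Rightarrow> 'a set \<Rightarrow> bool" where
  "indep V d S \<longleftrightarrow> S \<subseteq> V \<and> (\<forall>u\<in>S. \<forall>v\<in>S. d u v \<noteq> 1)"

definition indep_num :: "'a set \<Rightarrow> ('a \<Rightarrow> 'a \<Rightarrow> nat) \<Rightarrow> nat" where
  "indep_num V d = Max (card ` {S. indep V d S})"

text \<open>The bound of the theorem, with \<open>m\<close> in the place of \<alpha>.\<close>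

definition spur_harary :: "nat \<Rightarrow> nat \<Rightarrow> real" where
  "spur_harary n m = 1 / 24 * (3 * real n ^ 2 + 2 * real m * real n + real m ^ 2
             - 9 * real m + 19 * real n - 22)"

text \<open>
  The path metric of a tree, restricted to its vertices. Every \<open>x \<noteq> y\<close> has exactly one neighbour
  closer to \<open>y\<close>, and all other neighbours of \<open>x\<close> are one step further away; this is the tree property.
  Deleting a leaf shrinks \<open>V\<close> and leaves \<open>d\<close> unchanged.
\<close>

locale tree_dist =
  fixes V :: "'a set" and d :: "'a \<Rightarrow> 'a \<Rightarrow> nat"
  assumes finite_V: "finite V"
    and dist_eq_0: "x \<in> V \<Longrightarrow> y \<in> V \<Longrightarrow> d x y = 0 \<longleftrightarrow> x = y"
    and dist_sym: "x \<in> V \<Longrightarrow> y \<in> V \<Longrightarrow> d x y = d y x"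
    and toward: "x \<in> V \<Longrightarrow> y \<in> V \<Longrightarrow> x \<noteq> y \<Longrightarrow>
      \<exists>p\<in>V. d x p = 1 \<and> d x y = Suc (d p y) \<and>
        (\<forall>z\<in>V. d x z = 1 \<longrightarrow> z \<noteq> p \<longrightarrow> d z y = Suc (d x y))"
begin

section \<open>Neighbours and parents\<close>

lemma dist_self: "x \<in> V \<Longrightarrow> d x x = 0"
  by (simp add: dist_eq_0)

lemma nbrs_subset: "nbrs V d x \<subseteq> V"
  by (auto simp: nbrs_def)

lemma finite_nbrs: "finite (nbrs V d x)"
  using finite_V nbrs_subset by (rule finite_subset[rotated])

lemma self_notin_nbrs: "x \<in> V \<Longrightarrow> x \<notin> nbrs V d x"
  by (simp add: nbrs_def dist_self)

lemma nbrs_sym: "x \<in> V \<Longrightarrow> y \<in> nbrs V d x \<Longrightarrow> x \<in> nbrs V d y"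
  by (auto simp: nbrs_def dist_sym)

lemma parentE:
  assumes "x \<in> V" "y \<in> V" "x \<noteq> y"
  obtains p where "p \<in> nbrs V d x" "d x y = Suc (d p y)"
  using toward[OF assms] by (auto simp: nbrs_def)

text \<open>The neighbour of \<open>x\<close> towards \<open>y\<close> is one step closer, all
  others are one step further. So distances to a fixed vertex never agree at the two ends of an
  edge: a tree is bipartite.\<close>

lemma nbr_dist:
  assumes "x \<in> V" "y \<in> V" "z \<in> nbrs V d x"
  shows "d z y = Suc (d x y) \<or> d x y = Suc (d z y)"
proof (cases "x = y")
  case True
  then have "d x y = 0" "d z y = 1"
    using assms dist_sym[of z x] by (simp_all add: nbrs_def dist_self)
  then show ?thesis by simp
next
  case False
  from toward[OF assms(1,2) this] obtain p where
    "d x y = Suc (d p y)" "\<forall>z\<in>V. d x z = 1 \<longrightarrow> z \<noteq> p \<longrightarrow> d z y = Suc (d x y)" by blast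
  then show ?thesis using assms(3) by (cases "z = p") (auto simp: nbrs_def)
qed

lemma parent_unique:
  assumes "x \<in> V" "y \<in> V" "z \<in> nbrs V d x" "z' \<in> nbrs V d x"
    "d x y = Suc (d z y)" "d x y = Suc (d z' y)"
  shows "z = z'"
proof -
  have "x \<noteq> y" using assms dist_self by force
  from toward[OF assms(1,2) this] obtain p where
    "p \<in> V" "\<forall>z\<in>V. d x z = 1 \<longrightarrow> z \<noteq> p \<longrightarrow> d z y = Suc (d x y)"
    by (elim bexE conjE)
  have "a = p" if "a \<in> nbrs V d x" "d x y = Suc (d a y)" for a
  proof (rule ccontr)
    assume "a \<noteq> p"
    then have "d a y = Suc (d x y)"
      using \<open>\<forall>z\<in>V. _\<close> that(1) by (auto simp: nbrs_def)
    then show False using that(2) by linarith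
  qed
  then show ?thesis using assms by blast
qed

text \<open>An edge between two neighbours of \<open>c\<close> would join vertices equally far from
  \<open>c\<close>, against \<open>nbr_dist\<close>.\<close>

lemma nbrs_not_adjacent:
  assumes "c \<in> V" "u \<in> nbrs V d c" "v \<in> nbrs V d c"
  shows "d u v \<noteq> 1"
proof
  assume "d u v = 1"
  then have "v \<in> nbrs V d u" using assms by (auto simp: nbrs_def)
  moreover have "d u c = 1" "d v c = 1" "u \<in> V"
    using assms dist_sym[of c u] dist_sym[of c v] by (auto simp: nbrs_def)
  ultimately show False
    using nbr_dist[of u c v] assms(1) by simp
qed

section \<open>Independent sets\<close>

lemma finite_indep: "finite {S. indep V d S}"
  by (rule finite_subset[of _ "Pow V"]) (auto simp: indep_def finite_V)

lemma indep_empty: "indep V d {}"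
  by (auto simp: indep_def)

lemma card_le_indep_num: "indep V d S \<Longrightarrow> card S \<le> indep_num V d"
  unfolding indep_num_def using finite_indep by (intro Max_ge) auto

lemma indep_numE:
  obtains S where "indep V d S" "card S = indep_num V d"
proof -
  have "indep_num V d \<in> card ` {S. indep V d S}"
    unfolding indep_num_def using finite_indep indep_empty by (intro Max_in) auto
  then show ?thesis using that by auto
qed

lemma indep_finite: "indep V d S \<Longrightarrow> finite S"
  using finite_V by (auto simp: indep_def intro: finite_subset)

lemma indep_nbrs: "c \<in> V \<Longrightarrow> indep V d (nbrs V d c)"
  using nbrs_not_adjacent nbrs_subset by (auto simp: indep_def)

lemma degree_le_indep_num: "c \<in> V \<Longrightarrow> card (nbrs V d c) \<le> indep_num V d"
  by (simp add: card_le_indep_num indep_nbrs)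

text \<open>The vertices at even and at odd distance from a root are independent.\<close>

lemma card_le_twice_indep_num: "card V \<le> 2 * indep_num V d"
proof (cases "V = {}")
  case False
  then obtain r where r: "r \<in> V" by blast
  define A where "A = {x\<in>V. even (d x r)}"
  define B where "B = {x\<in>V. odd (d x r)}"
  have "even (d x r) \<noteq> even (d y r)" if "x \<in> V" "y \<in> V" "d x y = 1" for x y
    using nbr_dist[OF that(1) r, of y] that by (auto simp: nbrs_def)
  then have "indep V d A" "indep V d B"
    unfolding indep_def A_def B_def by blast+
  then have "card A \<le> indep_num V d" "card B \<le> indep_num V d"
    by (auto intro: card_le_indep_num)
  moreover have "card V = card A + card B"
    using finite_V unfolding A_def B_def
    by (subst card_Un_disjoint[symmetric]) (auto intro!: arg_cong[where f = card])
  ultimately show ?thesis by simp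
qed simp

section \<open>Deleting a leaf\<close>

lemma leaf_dist:
  assumes "v \<in> V" "nbrs V d v = {w}" "y \<in> V" "y \<noteq> v"
  shows "d v y = Suc (d w y)"
  using parentE[OF assms(1,3)] assms by auto

text \<open>Distances are kept because the parent of a remaining \<open>x\<close> towards a
  remaining \<open>y\<close> is never the leaf \<open>v\<close>.\<close>

lemma tree_dist_remove_leaf:
  assumes "v \<in> V" "nbrs V d v = {w}"
  shows "tree_dist (V - {v}) d"
proof
  fix x y assume xy: "x \<in> V - {v}" "y \<in> V - {v}" "x \<noteq> y"
  then obtain p where p: "p\<in>V" "d x p = 1" "d x y = Suc (d p y)"
     and u: "\<forall>z\<in>V. d x z = 1 \<longrightarrow> z \<noteq> p \<longrightarrow> d z y = Suc (d x y)"
    using toward[of x y] by auto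
  have "p \<noteq> v"
  proof
    assume "p = v"
    then have "x \<in> nbrs V d v" using xy p nbrs_sym[of x v] by (auto simp: nbrs_def)
    \<comment> \<open>Only \<open>w\<close> is adjacent to \<open>v\<close>, and from
      \<open>w\<close> the step to \<open>v\<close> leads away from \<open>y\<close>.\<close>
    then have "x = w" using assms by simp
    then show False using leaf_dist[OF assms, of y] xy p \<open>p = v\<close> by simp
  qed
  then show "\<exists>p\<in>V - {v}. d x p = 1 \<and> d x y = Suc (d p y) \<and>
        (\<forall>z\<in>V - {v}. d x z = 1 \<longrightarrow> z \<noteq> p \<longrightarrow> d z y = Suc (d x y))"
    using p u by (intro bexI[of _ p]) auto
next
  show "finite (V - {v})" using finite_V by simp
qed (simp_all add: dist_eq_0 dist_sym)

text \<open>Each pair containing \<open>v\<close> occurs once in the row of \<open>v\<close> and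
  once in another row; the division by 2 in \<open>harary\<close> merges the two copies.\<close>

lemma harary_remove:
  assumes "v \<in> V"
  shows "harary V d = harary (V - {v}) d + (\<Sum>y\<in>V - {v}. 1 / real (d v y))"
proof -
  define U where "U = V - {v}"
  have U: "finite U" "v \<notin> U" and V: "insert v U = V" using finite_V assms by (auto simp: U_def)
  have "(\<Sum>u\<in>V. \<Sum>y\<in>V - {u}. 1 / real (d u y)) =
     (\<Sum>y\<in>U. 1 / real (d v y)) + (\<Sum>u\<in>U. \<Sum>y\<in>V - {u}. 1 / real (d u y))"
    using sum.remove[OF finite_V assms] by (simp add: U_def)
  also have "(\<Sum>u\<in>U. \<Sum>y\<in>V - {u}. 1 / real (d u y)) =
     (\<Sum>u\<in>U. 1 / real (d v u) + (\<Sum>y\<in>U - {u}. 1 / real (d u y)))"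
  proof (rule sum.cong)
    fix u assume u: "u \<in> U"
    then have "V - {u} = insert v (U - {u})" using U V by blast
    moreover have "d u v = d v u" using u assms dist_sym by (auto simp: U_def)
    ultimately show "(\<Sum>y\<in>V - {u}. 1 / real (d u y)) = 1 / real (d v u) + (\<Sum>y\<in>U - {u}. 1 / real (d u y))"
      using U by simp
  qed simp
  finally show ?thesis unfolding harary_def U_def by (simp add: sum.distrib)
qed

lemma harary_remove_leaf:
  assumes "v \<in> V" "nbrs V d v = {w}"
  shows "harary V d = harary (V - {v}) d + (\<Sum>y\<in>V - {v}. 1 / (real (d w y) + 1))"
  unfolding harary_remove[OF assms(1)] by (simp add: leaf_dist[OF assms] add.commute)

lemma nbrs_remove: "nbrs (V - A) d x = nbrs V d x - A"
  by (auto simp: nbrs_def)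

section \<open>Sums of reciprocal distances\<close>

text \<open>The shift \<open>k\<close> will be 1 for a leaf hanging on \<open>x\<close> and 2 for
  the far end of a pendant path of two edges at \<open>x\<close>. The split is by distance 0, 1 and
  at least 2 from \<open>x\<close>.\<close>

lemma sum_shifted_dist:
  fixes k :: nat
  assumes "x \<in> V" "k > 0"
  defines "D \<equiv> card (nbrs V d x)"
  defines "R \<equiv> V - insert x (nbrs V d x)"
  shows "(\<Sum>y\<in>V. 1 / (real (d x y) + real k)) =
     1 / real k + real D / (real k + 1) + (\<Sum>y\<in>R. 1 / (real (d x y) + real k))"
    and "real (card R) = real (card V) - 1 - real D"
    and "\<And>y. y \<in> R \<Longrightarrow> d x y \<ge> 2"
proof -
  have V: "V = insert x (nbrs V d x) \<union> R" "insert x (nbrs V d x) \<inter> R = {}" "finite R"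
    using assms(1) nbrs_subset finite_V by (auto simp: R_def)
  have "(\<Sum>y\<in>V. 1 / (real (d x y) + real k)) =
     (\<Sum>y\<in>insert x (nbrs V d x). 1 / (real (d x y) + real k)) + (\<Sum>y\<in>R. 1 / (real (d x y) + real k))"
    using V finite_nbrs by (subst V(1), subst sum.union_disjoint) auto
  also have "(\<Sum>y\<in>insert x (nbrs V d x). 1 / (real (d x y) + real k)) =
     1 / real k + (\<Sum>y\<in>nbrs V d x. 1 / (real (d x y) + real k))"
    using finite_nbrs self_notin_nbrs[OF assms(1)] by (simp add: dist_self assms(1))
  also have "(\<Sum>y\<in>nbrs V d x. 1 / (real (d x y) + real k)) = (\<Sum>y\<in>nbrs V d x. 1 / (real k + 1))"
    by (rule sum.cong) (auto simp: nbrs_def)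
  finally show "(\<Sum>y\<in>V. 1 / (real (d x y) + real k)) =
     1 / real k + real D / (real k + 1) + (\<Sum>y\<in>R. 1 / (real (d x y) + real k))"
    by (simp add: D_def)
  have "card V = Suc D + card R"
    using V finite_nbrs self_notin_nbrs[OF assms(1)]
    by (subst V(1), subst card_Un_disjoint) (auto simp: D_def)
  then show "real (card R) = real (card V) - 1 - real D" by simp
  show "d x y \<ge> 2" if "y \<in> R" for y
  proof -
    have "d x y \<noteq> 0" "d x y \<noteq> 1" using that assms(1) dist_eq_0[of x y] by (auto simp: R_def nbrs_def)
    then show ?thesis by simp
  qed
qed

text \<open>In \<open>b\<close> every vertex of \<open>R\<close> counts as if it were at distance 2,
  the least possible, so equality means that none lies further away.\<close>

lemma sum_shifted_dist_le:
  fixes k :: nat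
  assumes "x \<in> V" "k > 0"
  defines "b \<equiv> 1 / real k + real (card (nbrs V d x)) / (real k + 1) +
     (real (card V) - 1 - real (card (nbrs V d x))) / (real k + 2)"
  shows "(\<Sum>y\<in>V. 1 / (real (d x y) + real k)) \<le> b"
    and "(\<Sum>y\<in>V. 1 / (real (d x y) + real k)) = b \<longleftrightarrow> (\<forall>y\<in>V. d x y \<le> 2)"
proof -
  define R where "R = V - insert x (nbrs V d x)"
  note s = sum_shifted_dist[OF assms(1,2), folded R_def]
  have finR: "finite R" using finite_V by (simp add: R_def)
  have le: "1 / (real (d x y) + real k) \<le> 1 / (real k + 2)" if "y \<in> R" for y
    using s(3)[OF that] by (intro divide_left_mono) auto
  have b: "b = 1 / real k + real (card (nbrs V d x)) / (real k + 1) + (\<Sum>y\<in>R. 1 / (real k + 2))"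
    by (simp add: b_def s(2))
  show "(\<Sum>y\<in>V. 1 / (real (d x y) + real k)) \<le> b"
    unfolding b s(1) using sum_mono[of R, OF le] by simp
  have frac: "1 / (real a + real k) = 1 / (real k + 2) \<longleftrightarrow> a = 2" for a
    by (subst frac_eq_eq) (use assms(2) in auto)
  show "(\<Sum>y\<in>V. 1 / (real (d x y) + real k)) = b \<longleftrightarrow> (\<forall>y\<in>V. d x y \<le> 2)"
  proof
    assume "(\<Sum>y\<in>V. 1 / (real (d x y) + real k)) = b"
    then have "(\<Sum>y\<in>R. 1 / (real (d x y) + real k)) = (\<Sum>y\<in>R. 1 / (real k + 2))"
      unfolding b s(1) by linarith
    \<comment> \<open>A termwise inequality with equal sums is an equality in each term.\<close>
    then have "1 / (real (d x y) + real k) = 1 / (real k + 2)" if "y \<in> R" for y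
      using sum_mono_inv[of "\<lambda>y. 1 / (real (d x y) + real k)" R "\<lambda>y. 1 / (real k + 2)"]
        le finR that by blast
    then have R2: "d x y = 2" if "y \<in> R" for y
      using that frac by blast
    show "\<forall>y\<in>V. d x y \<le> 2"
    proof
      fix y assume "y \<in> V"
      then consider "y = x" | "d x y = 1" | "y \<in> R"
        by (auto simp: R_def nbrs_def)
      then show "d x y \<le> 2"
        by cases (simp_all add: R2 dist_self assms(1))
    qed
  next
    assume le2: "\<forall>y\<in>V. d x y \<le> 2"
    have "d x y = 2" if "y \<in> R" for y
    proof -
      have "y \<in> V" using that by (simp add: R_def)
      then show ?thesis using le2 s(3)[OF that] by (simp add: le_antisym)
    qed
    then have "(\<Sum>y\<in>R. 1 / (real (d x y) + real k)) = (\<Sum>y\<in>R. 1 / (real k + 2))"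
      by (intro sum.cong) simp_all
    then show "(\<Sum>y\<in>V. 1 / (real (d x y) + real k)) = b"
      unfolding b s(1) by linarith
  qed
qed

end

section \<open>The upper bound\<close>

context tree_dist
begin

section \<open>The independence number under deletion\<close>

lemma indep_insert_leaf:
  assumes "indep V d S" "v \<in> V" "nbrs V d v = {w}" "w \<notin> S"
  shows "indep V d (insert v S)"
proof -
  have "d v u \<noteq> 1" if "u \<in> S" for u
    using assms that by (auto simp: nbrs_def indep_def)
  moreover have "d u v = d v u" if "u \<in> S" for u
    using assms(1,2) that dist_sym by (auto simp: indep_def)
  ultimately show ?thesis
    using assms(1,2) dist_self[OF assms(2)] by (auto simp: indep_def)
qed

lemma leaf_nbr:
  assumes "v \<in> V" "nbrs V d v = {w}"
  shows "w \<in> V" "w \<noteq> v" "d v w = 1" "d w v = 1"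
proof -
  have "w \<in> nbrs V d v" using assms by simp
  then show wV: "w \<in> V" and "d v w = 1" by (auto simp: nbrs_def)
  then show "w \<noteq> v" "d w v = 1" using dist_self[OF assms(1)] dist_sym[OF assms(1) wV] by auto
qed

text \<open>Deleting \<open>v\<close> costs a set at most one vertex. Conversely, in a set avoiding
  \<open>v\<close> one may put \<open>v'\<close> in place of \<open>w\<close>, after which
  \<open>v\<close> can be added.\<close>

lemma indep_num_remove_twin_leaf:
  assumes "v \<in> V" "nbrs V d v = {w}" "v' \<in> V" "nbrs V d v' = {w}" "v \<noteq> v'"
  shows "indep_num V d = Suc (indep_num (V - {v}) d)"
proof (rule antisym)
  interpret U: tree_dist "V - {v}" d
    using assms(1,2) by (rule tree_dist_remove_leaf)
  note w = leaf_nbr[OF assms(1,2)] leaf_nbr[OF assms(3,4)]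
  obtain S where S: "indep V d S" "card S = indep_num V d" by (rule indep_numE)
  then have "indep (V - {v}) d (S - {v})" by (auto simp: indep_def)
  then have "card (S - {v}) \<le> indep_num (V - {v}) d" by (rule U.card_le_indep_num)
  moreover have "card S \<le> Suc (card (S - {v}))"
    by (auto simp: card_Diff_singleton_if)
  ultimately show "indep_num V d \<le> Suc (indep_num (V - {v}) d)" using S by linarith
  obtain S where S: "indep (V - {v}) d S" "card S = indep_num (V - {v}) d" by (rule U.indep_numE)
  then have S': "indep V d S" "v \<notin> S" "finite S"
    using U.indep_finite by (auto simp: indep_def)
  define S1 where "S1 = insert v' (S - {w})"
  \<comment> \<open>If \<open>w\<close> is in \<open>S\<close>, its neighbour \<open>v'\<close> is
    not, so the exchange does not shrink the set.\<close>
  have "v' \<notin> S" if "w \<in> S"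
    using that w S' by (auto simp: indep_def)
  then have "card S \<le> card S1"
    using S'(3) unfolding S1_def by (cases "w \<in> S") (auto simp: card_Suc_Diff1 intro: card_mono)
  moreover have "indep V d S1"
    unfolding S1_def using S'(1) assms(3,4)
    by (intro indep_insert_leaf) (auto simp: indep_def)
  then have "indep V d (insert v S1)"
    using w by (intro indep_insert_leaf[OF _ assms(1,2)]) (auto simp: S1_def)
  then have "card (insert v S1) \<le> indep_num V d" by (rule card_le_indep_num)
  moreover have "card (insert v S1) = Suc (card S1)"
    using S' assms(5) by (simp add: S1_def)
  ultimately show "Suc (indep_num (V - {v}) d) \<le> indep_num V d" using S by linarith
qed

text \<open>Once \<open>v\<close> is gone, \<open>w\<close> is a leaf at \<open>x\<close>, so the
  path is deleted by two leaf removals.\<close>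

lemma pendant_path_leaf:
  assumes "v \<in> V" "nbrs V d v = {w}" "nbrs V d w = {v, x}" "x \<noteq> v"
  shows "tree_dist (V - {v}) d" "w \<in> V - {v}" "nbrs (V - {v}) d w = {x}"
    "tree_dist (V - {v, w}) d" "V - {v} - {w} = V - {v, w}"
proof -
  interpret U: tree_dist "V - {v}" d
    using assms(1,2) by (rule tree_dist_remove_leaf)
  show "tree_dist (V - {v}) d" by unfold_locales
  show "w \<in> V - {v}" using leaf_nbr[OF assms(1,2)] by simp
  moreover show "nbrs (V - {v}) d w = {x}" using assms(3,4) by (auto simp: nbrs_remove)
  ultimately have "tree_dist (V - {v} - {w}) d" by (rule U.tree_dist_remove_leaf)
  moreover show "V - {v} - {w} = V - {v, w}" by auto
  ultimately show "tree_dist (V - {v, w}) d" by simp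
qed

text \<open>An independent set contains at most one of the adjacent \<open>v\<close> and
  \<open>w\<close>; conversely the leaf \<open>v\<close> can join every set that avoids
  \<open>w\<close>.\<close>

lemma indep_num_remove_pendant_path:
  assumes "v \<in> V" "nbrs V d v = {w}" "nbrs V d w = {v, x}" "x \<noteq> v"
  shows "indep_num V d = Suc (indep_num (V - {v, w}) d)"
proof (rule antisym)
  interpret U: tree_dist "V - {v, w}" d
    using pendant_path_leaf[OF assms] by simp
  note w = leaf_nbr[OF assms(1,2)]
  obtain S where S: "indep V d S" "card S = indep_num V d" by (rule indep_numE)
  then have "indep (V - {v, w}) d (S - {v, w})" by (auto simp: indep_def)
  then have "card (S - {v, w}) \<le> indep_num (V - {v, w}) d" by (rule U.card_le_indep_num)
  moreover have "card S \<le> Suc (card (S - {v, w}))"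
  proof -
    have "v \<notin> S \<or> w \<notin> S" using S w by (auto simp: indep_def)
    \<comment> \<open>\<open>a\<close> is whichever of \<open>v\<close> and \<open>w\<close> may lie
      in \<open>S\<close>.\<close>
    then obtain a where "S \<subseteq> insert a (S - {v, w})" by blast
    moreover have "finite (S - {v, w})" using indep_finite[OF S(1)] by simp
    ultimately have "card S \<le> card (insert a (S - {v, w}))" by (intro card_mono) auto
    also have "\<dots> \<le> Suc (card (S - {v, w}))" using \<open>finite (S - {v, w})\<close> by (simp add: card_insert_if)
    finally show ?thesis .
  qed
  ultimately show "indep_num V d \<le> Suc (indep_num (V - {v, w}) d)" using S by linarith
  obtain S where S: "indep (V - {v, w}) d S" "card S = indep_num (V - {v, w}) d" by (rule U.indep_numE)
  then have S': "indep V d S" "v \<notin> S" "w \<notin> S" "finite S"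
    using U.indep_finite by (auto simp: indep_def)
  then have "indep V d (insert v S)"
    using assms(1,2) by (intro indep_insert_leaf)
  then have "card (insert v S) \<le> indep_num V d" by (rule card_le_indep_num)
  then show "Suc (indep_num (V - {v, w}) d) \<le> indep_num V d" using S S' by simp
qed

section \<open>The Harary index under deletion\<close>

text \<open>The case \<open>k = 1\<close> of \<open>sum_shifted_dist_le\<close> at \<open>w\<close>
  in the tree without \<open>v\<close>, where the order and the degree of \<open>w\<close> are both
  one less; \<open>b\<close> rewrites that bound in terms of \<open>V\<close>.\<close>

lemma harary_remove_leaf_le:
  assumes "v \<in> V" "nbrs V d v = {w}"
  defines "b \<equiv> harary (V - {v}) d + (1 + real (card (nbrs V d w)) + 2 * real (card V)) / 6"
  shows "harary V d \<le> b" "harary V d = b \<longleftrightarrow> (\<forall>y\<in>V. d w y \<le> 2)"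
proof -
  interpret U: tree_dist "V - {v}" d
    using assms(1,2) by (rule tree_dist_remove_leaf)
  note w = leaf_nbr[OF assms(1,2)]
  have c: "real (card V) = real (card (V - {v})) + 1"
    using card.remove[OF finite_V assms(1)] by linarith
  have "v \<in> nbrs V d w" using w assms(1) by (simp add: nbrs_def)
  then have D: "real (card (nbrs V d w)) = real (card (nbrs (V - {v}) d w)) + 1"
    using card.remove[OF finite_nbrs, of v w] unfolding nbrs_remove by linarith
  have wU: "w \<in> V - {v}" using w by simp
  note s = U.sum_shifted_dist_le[OF wU, of 1]
  have b: "b = harary (V - {v}) d + (1 / real 1 + real (card (nbrs (V - {v}) d w)) / (real 1 + 1) +
       (real (card (V - {v})) - 1 - real (card (nbrs (V - {v}) d w))) / (real 1 + 2))"
    unfolding b_def c D by (simp add: field_simps)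
  show "harary V d \<le> b"
    using s(1) unfolding b harary_remove_leaf[OF assms(1,2)] by simp
  have "harary V d = b \<longleftrightarrow> (\<forall>y\<in>V-{v}. d w y \<le> 2)"
    using s(2) unfolding b harary_remove_leaf[OF assms(1,2)] by simp
  also have "\<dots> \<longleftrightarrow> (\<forall>y\<in>V. d w y \<le> 2)"
    using w(4) by fastforce
  finally show "harary V d = b \<longleftrightarrow> (\<forall>y\<in>V. d w y \<le> 2)" .
qed

text \<open>The pair \<open>v\<close>, \<open>w\<close> contributes 1. All other distances from
  \<open>w\<close> and from \<open>v\<close> are those from \<open>x\<close> plus 1 and plus 2, so
  the cases \<open>k = 1\<close> and \<open>k = 2\<close> apply at \<open>x\<close> in the tree
  without \<open>v\<close> and \<open>w\<close>.\<close>

lemma harary_remove_pendant_path_le: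
  assumes "v \<in> V" "nbrs V d v = {w}" "nbrs V d w = {v, x}" "x \<noteq> v"
  defines "b \<equiv> harary (V - {v, w}) d + (6 + 3 * real (card (nbrs V d x)) + 7 * real (card V)) / 12"
  shows "harary V d \<le> b" "harary V d = b \<longleftrightarrow> (\<forall>y\<in>V. d x y \<le> 2)"
proof -
  note P = pendant_path_leaf[OF assms(1-4)]
  interpret U: tree_dist "V - {v}" d by (rule P)
  interpret W: tree_dist "V - {v, w}" d by (rule P)
  note w = leaf_nbr[OF assms(1,2)]
  note x = U.leaf_nbr[OF P(2,3)]
  have xW: "x \<in> V - {v, w}" using x by auto
  have c: "real (card V) = real (card (V - {v, w})) + 2"
    using assms(1) w finite_V card_mono[of V "{v, w}"] by (simp add: card_Diff_subset)
  have vx: "d v x = 2" using leaf_dist[OF assms(1,2), of x] x by simp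
  have xv: "d x v = 2" using vx dist_sym[of v x] x(1) assms(1) by simp
  have "w \<in> nbrs V d x" "nbrs (V - {v, w}) d x = nbrs V d x - {w}"
    using x(4) w(1) xv by (auto simp: nbrs_def)
  then have D: "real (card (nbrs V d x)) = real (card (nbrs (V - {v, w}) d x)) + 1"
    using card.remove[OF finite_nbrs, of w x] by simp
  have "(\<Sum>y\<in>V - {v}. 1 / (real (d w y) + 1)) = 1 + (\<Sum>y\<in>V - {v, w}. 1 / (real (d w y) + 1))"
    unfolding sum.remove[OF U.finite_V P(2)] P(5) using dist_self[OF w(1)] by simp
  also have "(\<Sum>y\<in>V - {v, w}. 1 / (real (d w y) + 1)) = (\<Sum>y\<in>V - {v, w}. 1 / (real (d x y) + real 2))"
    using U.leaf_dist[OF P(2,3)] by (intro sum.cong) (auto simp: add.commute)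
  finally have H: "harary V d = harary (V - {v, w}) d + 1 + (\<Sum>y\<in>V - {v, w}. 1 / (real (d x y) + real 1)) +
      (\<Sum>y\<in>V - {v, w}. 1 / (real (d x y) + real 2))"
    using harary_remove_leaf[OF assms(1,2)] U.harary_remove_leaf[OF P(2,3)] P(5) by simp
  note s1 = W.sum_shifted_dist_le[OF xW, of 1] and s2 = W.sum_shifted_dist_le[OF xW, of 2]
  define b1 where "b1 = 1 / real 1 + real (card (nbrs (V - {v, w}) d x)) / (real 1 + 1) +
       (real (card (V - {v, w})) - 1 - real (card (nbrs (V - {v, w}) d x))) / (real 1 + 2)"
  define b2 where "b2 = 1 / real 2 + real (card (nbrs (V - {v, w}) d x)) / (real 2 + 1) +
       (real (card (V - {v, w})) - 1 - real (card (nbrs (V - {v, w}) d x))) / (real 2 + 2)"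
  have b: "b = harary (V - {v, w}) d + 1 + b1 + b2"
    unfolding b_def b1_def b2_def c D by (simp add: field_simps)
  note s = s1[folded b1_def] s2[folded b2_def]
  show "harary V d \<le> b"
    using s(1,3) unfolding b H by linarith
  \<comment> \<open>Both estimates must be tight, and they are so under the same condition.\<close>
  have "harary V d = b \<longleftrightarrow> (\<forall>y\<in>V-{v,w}. d x y \<le> 2)"
    using s unfolding b H by fastforce
  also have "\<dots> \<longleftrightarrow> (\<forall>y\<in>V. d x y \<le> 2)"
    using x(4) xv by fastforce
  finally show "harary V d = b \<longleftrightarrow> (\<forall>y\<in>V. d x y \<le> 2)" .
qed

section \<open>Leaves at the end of a longest path\<close>

lemma nbrs_nonempty:
  assumes "x \<in> V" "card V \<ge> 2"
  shows "nbrs V d x \<noteq> {}"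
proof -
  have "\<not> V \<subseteq> {x}" using card_mono[of "{x}" V] assms(2) by auto
  then obtain y where "y \<in> V" "y \<noteq> x" by blast
  then show ?thesis using parentE[OF assms(1), of y] by blast
qed

text \<open>At maximal distance from \<open>r\<close> every neighbour is a parent towards
  \<open>r\<close>, and there is only one parent.\<close>

lemma leafI:
  assumes "v \<in> V" "r \<in> V" "w \<in> nbrs V d v" "d v r = Suc (d w r)" "\<And>y. y \<in> V \<Longrightarrow> d y r \<le> d v r"
  shows "nbrs V d v = {w}"
proof -
  have "z = w" if "z \<in> nbrs V d v" for z
  proof -
    have "d v r = Suc (d z r)"
      using nbr_dist[OF assms(1,2) that] assms(5)[of z] that nbrs_subset by fastforce
    then show ?thesis using parent_unique assms that by blast
  qed
  then show ?thesis using assms(3) by blast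
qed

text \<open>Take \<open>w\<close> to be the parent of a vertex \<open>v\<close> at maximal distance from a root \<open>r\<close>.\<close>

lemma two_leaves_or_pendant_path:
  assumes "card V \<ge> 3"
  obtains (twin) v v' w where "v \<in> V" "v' \<in> V" "v \<noteq> v'" "nbrs V d v = {w}" "nbrs V d v' = {w}"
  | (path) v w x where "v \<in> V" "nbrs V d v = {w}" "nbrs V d w = {v, x}" "x \<noteq> v" "card V \<ge> 4"
proof -
  obtain r where r: "r \<in> V" using assms by (cases "V = {}") auto
  have "Max ((\<lambda>y. d y r) ` V) \<in> (\<lambda>y. d y r) ` V"
    using finite_V r by (intro Max_in) auto
  then obtain v where v: "v \<in> V" "d v r = Max ((\<lambda>y. d y r) ` V)" by auto
  have v_max: "d y r \<le> d v r" if "y \<in> V" for y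
    unfolding v(2) using finite_V that by (intro Max_ge) auto
  have "\<not> V \<subseteq> {r}" using card_mono[of "{r}" V] assms by auto
  then obtain u where u: "u \<in> V" "u \<noteq> r" by blast
  have "v \<noteq> r" using v_max[OF u(1)] u dist_eq_0[OF u(1) r] dist_self[OF r] by auto
  then obtain w where w: "w \<in> nbrs V d v" "d v r = Suc (d w r)"
    using parentE v(1) r by metis
  have leaf: "nbrs V d v = {w}" using leafI[OF v(1) r w v_max] .
  note wf = leaf_nbr[OF v(1) leaf]
  have vw: "v \<in> nbrs V d w" using wf v by (simp add: nbrs_def)
  show thesis
  proof (cases "\<exists>v'\<in>V. v' \<noteq> v \<and> nbrs V d v' = {w}")
    case True
    then show ?thesis using twin v(1) leaf by metis
  next
    case False
    \<comment> \<open>Every child of \<open>w\<close> is as far from \<open>r\<close> as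
      \<open>v\<close>, hence a leaf at \<open>w\<close>, hence \<open>v\<close> itself, since twins
      are excluded in this case.\<close>
    have child: "z = v" if "z \<in> nbrs V d w" "d z r = Suc (d w r)" for z
    proof -
      have "w \<in> nbrs V d z" using that nbrs_sym wf by blast
      then have "nbrs V d z = {w}"
        using that w v_max r nbrs_subset by (intro leafI[of z r w]) auto
      then show ?thesis using False that nbrs_subset by blast
    qed
    \<comment> \<open>If \<open>w\<close> were the root, a third vertex would be reached from
      \<open>w\<close> through a child, that is through the leaf \<open>v\<close>.\<close>
    have "w \<noteq> r"
    proof
      assume wr: "w = r"
      obtain y where y: "y \<in> V" "y \<noteq> v" "y \<noteq> w"
      proof -
        have "\<not> V \<subseteq> {v, w}" using assms card_mono[of "{v, w}" V] card_insert_le_m1[of 2 "{w}" v] by auto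
        then show ?thesis using that by blast
      qed
      obtain p where p: "p \<in> nbrs V d w" "d w y = Suc (d p y)"
        using parentE[OF wf(1) y(1)] y by metis
      have "d p r = Suc (d w r)"
        using p wr nbrs_sym[OF wf(1) p(1)] dist_self[OF wf(1)] by (auto simp: nbrs_def)
      then have "p = v" using child p by blast
      then show False using leaf_dist[OF v(1) leaf y(1,2)] p by simp
    qed
    then obtain x where x: "x \<in> nbrs V d w" "d w r = Suc (d x r)"
      using parentE wf(1) r by metis
    have "x \<noteq> v" using x w by auto
    have N: "nbrs V d w = {v, x}"
    proof -
      have "z = v \<or> z = x" if "z \<in> nbrs V d w" for z
        using nbr_dist[OF wf(1) r that] child[OF that] parent_unique[OF wf(1) r that x(1)] x by blast
      then show ?thesis using vw x by blast
    qed
    have xV: "x \<in> V" "x \<noteq> w" using x nbrs_subset self_notin_nbrs[OF wf(1)] by blast+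
    \<comment> \<open>As \<open>x\<close> is not a second leaf at \<open>w\<close>, it has a further
      neighbour \<open>y\<close>. This fourth vertex ensures that at least two vertices survive the
      deletion of \<open>v\<close> and \<open>w\<close>.\<close>
    have "w \<in> nbrs V d x" using nbrs_sym wf(1) x by blast
    moreover have "nbrs V d x \<noteq> {w}" using False xV \<open>x \<noteq> v\<close> by blast
    ultimately obtain y where y: "y \<in> nbrs V d x" "y \<noteq> w" by blast
    have "y \<noteq> x" using y self_notin_nbrs[OF xV(1)] by blast
    moreover have "y \<noteq> v" using y nbrs_sym[OF xV(1) y(1)] leaf xV(2) by auto
    moreover have "y \<in> V" using y nbrs_subset by blast
    ultimately have "card {v, w, x, y} = 4" "{v, w, x, y} \<subseteq> V"
      using \<open>x \<noteq> v\<close> xV y wf v(1) by auto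
    then have "card V \<ge> 4" using card_mono[OF finite_V] by metis
    then show ?thesis using path[OF v(1) leaf N \<open>x \<noteq> v\<close>] by blast
  qed
qed

end

section \<open>The induction for the bound\<close>

text \<open>The increment is the loss in \<open>harary_remove_leaf_le\<close> with the degree of
  \<open>w\<close> replaced by the independence number. The next recursion matches
  \<open>harary_remove_pendant_path_le\<close> in the same way.\<close>

lemma spur_harary_Suc:
  "spur_harary (Suc n) (Suc m) = spur_harary n m + (1 + real (Suc m) + 2 * real (Suc n)) / 6"
  by (simp add: spur_harary_def power2_eq_square field_simps)

lemma spur_harary_Suc_Suc:
  "spur_harary (Suc (Suc n)) (Suc m) =
     spur_harary n m + (6 + 3 * real (Suc m) + 7 * real (Suc (Suc n))) / 12"
  by (simp add: spur_harary_def power2_eq_square field_simps)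

text \<open>The loss is compared with the recursions for \<open>spur_harary\<close>, using that
  degrees are at most the independence number. The equality clause is read off from the last
  deletion alone: there both the degree bound and the distance estimate must be tight.\<close>

lemma harary_le:
  assumes "tree_dist V d" "card V \<ge> 2"
  shows "harary V d \<le> spur_harary (card V) (indep_num V d) \<and>
    (harary V d = spur_harary (card V) (indep_num V d) \<longrightarrow>
      (\<exists>c\<in>V. card (nbrs V d c) = indep_num V d \<and> (\<forall>y\<in>V. d c y \<le> 2)))"
  using assms
proof (induction "card V" arbitrary: V rule: less_induct)
  case less
  interpret tree_dist V d by fact
  show ?case
  proof (cases "card V \<ge> 3")
    \<comment> \<open>Two vertices, where both sides are 1.\<close>
    case False
    then have c2: "card V = 2" using less.prems by linarith
    then obtain a b where ab: "V = {a, b}" "a \<noteq> b" by (meson card_2_iff)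
    have N: "nbrs V d a = {b}" "nbrs V d b = {a}"
      using nbrs_nonempty[of a] nbrs_nonempty[of b] self_notin_nbrs[of a] self_notin_nbrs[of b]
        nbrs_subset c2 ab by auto
    then have d1: "d a b = 1" "d b a = 1" by (auto simp: nbrs_def)
    have "indep_num V d = 1"
    proof (rule antisym)
      obtain S where S: "indep V d S" "card S = indep_num V d" by (rule indep_numE)
      then have "S \<subseteq> {a} \<or> S \<subseteq> {b}" using d1 unfolding indep_def ab by blast
      then have "card S \<le> 1" using card_mono[of "{a}" S] card_mono[of "{b}" S] by auto
      then show "indep_num V d \<le> 1" using S by simp
      show "1 \<le> indep_num V d" using degree_le_indep_num[of a] N ab by simp
    qed
    moreover have "harary V d = 1" using ab d1 by (simp add: harary_def insert_Diff_if)
    moreover have "spur_harary 2 1 = 1" by (simp add: spur_harary_def)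
    moreover have "\<forall>y\<in>V. d a y \<le> 2" using ab d1 dist_self[of a] by simp
    ultimately show ?thesis using c2 N ab(1) by fastforce
  next
    case True
    then show ?thesis
    proof (cases rule: two_leaves_or_pendant_path)
      case (twin v v' w)
      note a = indep_num_remove_twin_leaf[OF twin(1,4,2,5,3)]
      note h = harary_remove_leaf_le[OF twin(1,4)]
      have c: "card V = Suc (card (V - {v}))"
        by (rule card.remove[OF finite_V twin(1)])
      have IH: "harary (V - {v}) d \<le> spur_harary (card (V - {v})) (indep_num (V - {v}) d)"
        using less.hyps[of "V - {v}"] tree_dist_remove_leaf[OF twin(1,4)] c True by simp
      have wV: "w \<in> V" using leaf_nbr[OF twin(1,4)] by simp
      have deg: "card (nbrs V d w) \<le> indep_num V d" by (rule degree_le_indep_num[OF wV])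
      have s: "spur_harary (card V) (indep_num V d) =
          spur_harary (card (V - {v})) (indep_num (V - {v}) d) +
            (1 + real (indep_num V d) + 2 * real (card V)) / 6"
        unfolding a c by (rule spur_harary_Suc)
      have "harary V d \<le> spur_harary (card V) (indep_num V d)"
        using h(1) IH s deg by (simp add: field_simps)
      moreover have "card (nbrs V d w) = indep_num V d \<and> (\<forall>y\<in>V. d w y \<le> 2)"
        if "harary V d = spur_harary (card V) (indep_num V d)"
      proof -
        \<comment> \<open>The smaller tree does not exceed its bound, so equality is possible only
          if the degree of \<open>w\<close> is as large as allowed.\<close>
        have "real (card (nbrs V d w)) \<ge> real (indep_num V d)"
          using h(1) IH s that by (simp add: field_simps)
        then have deg_eq: "card (nbrs V d w) = indep_num V d" using deg by simp
        moreover have "harary V d = harary (V - {v}) d + (1 + real (card (nbrs V d w)) + 2 * real (card V)) / 6"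
          using h(1) IH s that unfolding deg_eq by linarith
        ultimately show ?thesis using h(2) by blast
      qed
      ultimately show ?thesis using wV by blast
    next
      case (path v w x)
      note P = pendant_path_leaf[OF path(1-4)]
      note a = indep_num_remove_pendant_path[OF path(1-4)]
      note h = harary_remove_pendant_path_le[OF path(1-4)]
      have wV: "w \<in> V" using leaf_nbr[OF path(1,2)] by simp
      have c: "card V = Suc (Suc (card (V - {v, w})))"
        using path(1) finite_V P(2) wV card_mono[of V "{v, w}"] by (simp add: card_Diff_subset)
      have IH: "harary (V - {v, w}) d \<le> spur_harary (card (V - {v, w})) (indep_num (V - {v, w}) d)"
        using less.hyps[of "V - {v, w}"] P(4) c path(5) by simp
      have xV: "x \<in> V" using path(3) nbrs_subset by blast
      have deg: "card (nbrs V d x) \<le> indep_num V d" by (rule degree_le_indep_num[OF xV])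
      have s: "spur_harary (card V) (indep_num V d) =
          spur_harary (card (V - {v, w})) (indep_num (V - {v, w}) d) +
            (6 + 3 * real (indep_num V d) + 7 * real (card V)) / 12"
        unfolding a c by (rule spur_harary_Suc_Suc)
      have "harary V d \<le> spur_harary (card V) (indep_num V d)"
        using h(1) IH s deg by (simp add: field_simps)
      moreover have "card (nbrs V d x) = indep_num V d \<and> (\<forall>y\<in>V. d x y \<le> 2)"
        if "harary V d = spur_harary (card V) (indep_num V d)"
      proof -
        have "real (card (nbrs V d x)) \<ge> real (indep_num V d)"
          using h(1) IH s that by (simp add: field_simps)
        then have deg_eq: "card (nbrs V d x) = indep_num V d" using deg by simp
        moreover have "harary V d = harary (V - {v, w}) d + (6 + 3 * real (card (nbrs V d x)) + 7 * real (card V)) / 12"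
          using h(1) IH s that unfolding deg_eq by linarith
        ultimately show ?thesis using h(2) by blast
      qed
      ultimately show ?thesis using xV by blast
    qed
  qed
qed

section \<open>The extremal trees\<close>

context tree_dist
begin

text \<open>Two vertices force an edge, so \<open>V\<close> is not independent. This gives the upper
  end of the range of \<open>m\<close> for spurs.\<close>

lemma indep_num_less_card:
  assumes "card V \<ge> 2"
  shows "indep_num V d < card V"
proof -
  obtain S where S: "indep V d S" "card S = indep_num V d" by (rule indep_numE)
  have "S \<noteq> V"
  proof
    assume "S = V"
    obtain x where x: "x \<in> V" using assms by (cases "V = {}") auto
    then obtain y where "y \<in> nbrs V d x" using nbrs_nonempty[OF x assms] by blast
    then show False using S(1) \<open>S = V\<close> x by (auto simp: indep_def nbrs_def)
  qed
  then have "card S < card V" using S(1) finite_V by (intro psubset_card_mono) (auto simp: indep_def)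
  then show ?thesis using S by simp
qed

lemma nbr_of_nbr_dist:
  assumes "c \<in> V" "b \<in> nbrs V d c" "y \<in> nbrs V d b" "y \<noteq> c"
  shows "d y c = 2"
proof -
  have b: "b \<in> V" "d b c = 1" using assms dist_sym[of b c] by (auto simp: nbrs_def)
  have y: "y \<in> V" using assms by (auto simp: nbrs_def)
  then have "d y c \<noteq> 0" using assms dist_eq_0 by blast
  then show ?thesis using nbr_dist[OF b(1) assms(1,3)] b by simp
qed

text \<open>Replacing \<open>b\<close> in the independent set \<open>nbrs V d c\<close> by the neighbours of \<open>b\<close> other than \<open>c\<close>
  gives another independent set.\<close>

lemma degree_nbr_le_2:
  assumes "c \<in> V" "card (nbrs V d c) = indep_num V d" "b \<in> nbrs V d c"
  shows "card (nbrs V d b) \<le> 2"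
proof -
  define A where "A = nbrs V d c - {b}"
  define B where "B = nbrs V d b - {c}"
  have b: "b \<in> V" "d b c = 1" using assms dist_sym[of b c] by (auto simp: nbrs_def)
  have cb: "c \<in> nbrs V d b" using assms nbrs_sym by blast
  have AV: "A \<subseteq> V" "B \<subseteq> V" using nbrs_subset by (auto simp: A_def B_def)
  have A1: "d u c = 1" if "u \<in> A" for u
    using that assms(1) dist_sym[of u c] by (auto simp: A_def nbrs_def)
  have B2: "d y c = 2" if "y \<in> B" for y
    using that assms nbr_of_nbr_dist by (auto simp: B_def)
  \<comment> \<open>Such an edge would give \<open>y\<close> two parents towards \<open>c\<close>,
    namely \<open>u\<close> and \<open>b\<close>.\<close>
  have BA: "d y u \<noteq> 1" if "y \<in> B" "u \<in> A" for y u
  proof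
    assume "d y u = 1"
    then have "u \<in> nbrs V d y" using that AV by (auto simp: nbrs_def)
    moreover have "b \<in> nbrs V d y" using that b nbrs_sym by (auto simp: B_def)
    ultimately have "u = b"
      using parent_unique[of y c u b] A1 B2 b that AV assms(1) by auto
    then show False using that by (simp add: A_def)
  qed
  then have AB: "d u y \<noteq> 1" if "y \<in> B" "u \<in> A" for y u
    using that AV dist_sym[of u y] by (metis subsetD)
  have "indep V d (A \<union> B)"
    unfolding indep_def
  proof (intro conjI ballI)
    fix u v assume "u \<in> A \<union> B" "v \<in> A \<union> B"
    then show "d u v \<noteq> 1"
      using AB BA nbrs_not_adjacent[OF assms(1), of u v] nbrs_not_adjacent[OF b(1), of u v]
      by (auto simp: A_def B_def)
  qed (use AV in blast)
  then have "card (A \<union> B) \<le> indep_num V d" by (rule card_le_indep_num)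
  moreover have "card (A \<union> B) = card A + card B"
    using A1 B2 finite_nbrs by (intro card_Un_disjoint) (force simp: A_def B_def)+
  \<comment> \<open>Since \<open>A\<close> has one element less than \<open>nbrs V d c\<close>,
    there is room for at most one vertex in \<open>B\<close>.\<close>
  moreover have "card (nbrs V d c) = Suc (card A)" "card (nbrs V d b) = Suc (card B)"
    unfolding A_def B_def using card.remove[OF finite_nbrs] assms(3) cb by blast+
  ultimately show ?thesis using assms(2) by linarith
qed

text \<open>With \<open>c\<close> as root, 2 is the maximal distance, so \<open>leafI\<close>
  applies.\<close>

lemma far_vertex_leaf:
  assumes "c \<in> V" "\<forall>y\<in>V. d c y \<le> 2" "v \<in> V" "d v c = 2" "w \<in> nbrs V d v" "d w c = 1"
  shows "nbrs V d v = {w}"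
  using assms(2) dist_sym[OF _ assms(1)] assms by (intro leafI[of v c w]) auto

end

section \<open>Spiders with legs of length at most two\<close>

text \<open>The legs are peeled off one by one. As every vertex is within distance 2 of
  \<open>c\<close>, the removal estimates at \<open>c\<close> are equalities, and each leg lowers
  the degree of \<open>c\<close> by one, as the recursions for \<open>spur_harary\<close>
  require.\<close>

lemma harary_spider:
  assumes "tree_dist V d" "c \<in> V" "\<forall>y\<in>V. d c y \<le> 2" "\<forall>b\<in>nbrs V d c. card (nbrs V d b) \<le> 2"
  shows "harary V d = spur_harary (card V) (card (nbrs V d c))"
  using assms
proof (induction "card V" arbitrary: V rule: less_induct)
  case less
  interpret tree_dist V d by fact
  note cV = \<open>c \<in> V\<close>
  have mono: "card (nbrs (V - A) d b) \<le> card (nbrs V d b)" for A b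
    using finite_nbrs by (auto simp: nbrs_remove intro: card_mono)
  have IH: "harary (V - A) d = spur_harary (card (V - A)) (card (nbrs V d c - A))"
    if "tree_dist (V - A) d" "c \<notin> A" "card (V - A) < card V" for A
  proof -
    have "\<forall>b\<in>nbrs (V - A) d c. card (nbrs (V - A) d b) \<le> 2"
      using less.prems(4) mono by (auto simp: nbrs_remove intro: order_trans)
    then show ?thesis
      using less.hyps[OF that(3,1)] cV less.prems(3) that(2) by (simp add: nbrs_remove)
  qed
  have c1: "c \<in> nbrs V d w" if "w \<in> nbrs V d c" for w
    using that nbrs_sym cV by blast
  consider "nbrs V d c = {}" | w where "w \<in> nbrs V d c" "nbrs V d w = {c}"
    | w where "w \<in> nbrs V d c" "nbrs V d w \<noteq> {c}" by blast
  then show ?case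
  proof cases
    \<comment> \<open>A single vertex: \<open>spur_harary 1 0\<close> is 0, the value of the empty
      sum.\<close>
    case 1
    then have "V = {c}" using parentE[OF cV] cV by blast
    then show ?thesis using 1 by (simp add: harary_def spur_harary_def)
  next
    case (2 w)
    have wV: "w \<in> V" using 2 nbrs_subset by blast
    have c: "card V = Suc (card (V - {w}))" by (rule card.remove[OF finite_V wV])
    have D: "card (nbrs V d c) = Suc (card (nbrs V d c - {w}))"
      by (rule card.remove[OF finite_nbrs 2(1)])
    have "c \<noteq> w" using 2 self_notin_nbrs[OF cV] by blast
    then have "harary (V - {w}) d = spur_harary (card (V - {w})) (card (nbrs V d c - {w}))"
      using tree_dist_remove_leaf[OF wV 2(2)] c by (intro IH) auto
    then show ?thesis
      using harary_remove_leaf_le(2)[OF wV 2(2)] less.prems(3) spur_harary_Suc c D by metis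
  next
    case (3 w)
    have wV: "w \<in> V" using 3 nbrs_subset by blast
    obtain v where v: "v \<in> nbrs V d w" "v \<noteq> c" using c1[OF 3(1)] 3(2) by blast
    \<comment> \<open>The degree bound leaves \<open>w\<close> only \<open>c\<close> and one outer
      neighbour \<open>v\<close>, so this leg has length 2.\<close>
    have "card (nbrs V d w) \<le> card {v, c}" using bspec[OF less.prems(4) 3(1)] v by simp
    then have N: "nbrs V d w = {v, c}"
      using card_seteq[OF finite_nbrs, of "{v, c}" w] v c1[OF 3(1)] by blast
    have vV: "v \<in> V" using v nbrs_subset by blast
    have vc: "d v c = 2" using nbr_of_nbr_dist[OF cV 3(1) v] .
    have wc: "d w c = 1" using 3(1) c1[OF 3(1)] by (simp add: nbrs_def)
    have leaf: "nbrs V d v = {w}"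
      using far_vertex_leaf[OF cV less.prems(3) vV vc _ wc] nbrs_sym[OF wV v(1)] by blast
    note P = pendant_path_leaf[OF vV leaf N v(2)[symmetric]]
    have c: "card V = Suc (Suc (card (V - {v, w})))"
      using card.remove[OF finite_V vV] card.remove[OF _ P(2)] P(5) finite_V by simp
    have "v \<notin> nbrs V d c" using vc vV dist_sym[OF vV cV] by (auto simp: nbrs_def)
    then have "nbrs V d c - {v, w} = nbrs V d c - {w}" by blast
    then have D: "card (nbrs V d c) = Suc (card (nbrs V d c - {v, w}))"
      using card.remove[OF finite_nbrs 3(1)] by simp
    have "c \<notin> {v, w}" using v 3(1) self_notin_nbrs[OF cV] by blast
    then have "harary (V - {v, w}) d = spur_harary (card (V - {v, w})) (card (nbrs V d c - {v, w}))"
      using P(4) c by (intro IH) auto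
    then show ?thesis
      using harary_remove_pendant_path_le(2)[OF vV leaf N v(2)[symmetric]] less.prems(3)
        spur_harary_Suc_Suc c D by metis
  qed
qed

section \<open>Spurs as labelled spiders\<close>

lemma parcs_spur:
  "(i, j) \<in> parcs (spur n m) \<longleftrightarrow>
     i = 0 \<and> 1 \<le> j \<and> j \<le> m \<or> j = 0 \<and> 1 \<le> i \<and> i \<le> m \<or>
     1 \<le> i \<and> i \<le> n - m - 1 \<and> j = m + i \<or> 1 \<le> j \<and> j \<le> n - m - 1 \<and> i = m + j"
  by (auto simp: spur_def Let_def)

lemma pverts_spur: "pverts (spur n m) = {..<n}"
  by (simp add: spur_def Let_def)

context tree_dist
begin

text \<open>\<open>V\<close> consists of \<open>c\<close>, its neighbours \<open>N\<close> and the
  vertices \<open>L\<close> at distance 2, which are leaves on distinct members of \<open>N\<close>.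
  Numbering first those members of \<open>N\<close> that carry a leaf makes the leaf at number
  \<open>i\<close> get the number \<open>m + i\<close>.\<close>

lemma spider_imp_spur:
  assumes "c \<in> V" "\<forall>y\<in>V. d c y \<le> 2" "\<forall>b\<in>nbrs V d c. card (nbrs V d b) \<le> 2"
  obtains \<phi> where "bij_betw \<phi> {..<card V} V"
    "\<And>i j. i < card V \<Longrightarrow> j < card V \<Longrightarrow>
      d (\<phi> i) (\<phi> j) = 1 \<longleftrightarrow> (i, j) \<in> parcs (spur (card V) (card (nbrs V d c)))"
proof -
  define N where "N = nbrs V d c"
  define L where "L = V - insert c N"
  define m where "m = card N"
  define k where "k = card L"
  have finN: "finite N" and cN: "c \<notin> N" and NV: "N \<subseteq> V"
    using finite_nbrs self_notin_nbrs[OF assms(1)] nbrs_subset by (auto simp: N_def)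
  have finL: "finite L" and LV: "L \<subseteq> V" and cL: "c \<notin> L" and NL: "N \<inter> L = {}"
    using finite_V by (auto simp: L_def)
  have V: "V = {c} \<union> N \<union> L" using assms(1) NV by (auto simp: L_def)
  have n: "card V = Suc (m + k)"
    unfolding V m_def k_def using finN finL cN cL NL by (simp add: card_Un_disjoint)
  have cd: "d x c = d c x" if "x \<in> V" for x by (rule dist_sym[OF that assms(1)])
  have N1: "x \<in> N \<longleftrightarrow> d c x = 1" if "x \<in> V" for x using that by (simp add: N_def nbrs_def)
  have L2: "d x c = 2" if "x \<in> L" for x
  proof -
    have "x \<in> V" "x \<noteq> c" "x \<notin> N" using that by (auto simp: L_def)
    then have "d c x \<noteq> 0" "d c x \<noteq> 1" "d c x \<le> 2"
      using assms(1,2) dist_eq_0[of c x] N1[of x] by auto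
    then show ?thesis using cd[OF \<open>x \<in> V\<close>] by simp
  qed
  have "\<exists>p\<in>N. nbrs V d x = {p}" if x: "x \<in> L" for x
  proof -
    have xV: "x \<in> V" "x \<noteq> c" using x LV cL by auto
    obtain p where p: "p \<in> nbrs V d x" "d x c = Suc (d p c)" using parentE[OF xV(1) assms(1) xV(2)] by blast
    have "d p c = 1" using p L2[OF x] by simp
    moreover have "p \<in> V" using p nbrs_subset by blast
    ultimately show ?thesis
      using far_vertex_leaf[OF assms(1,2) xV(1) L2[OF x] p(1)] N1 cd by auto
  qed
  then obtain par where par: "\<And>x. x \<in> L \<Longrightarrow> par x \<in> N" "\<And>x. x \<in> L \<Longrightarrow> nbrs V d x = {par x}"
    by metis
  \<comment> \<open>Two leaves on the same neighbour of \<open>c\<close> would, together with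
    \<open>c\<close>, give it degree at least 3.\<close>
  have inj_par: "inj_on par L"
  proof (rule inj_onI, rule ccontr)
    fix x y assume xy: "x \<in> L" "y \<in> L" "par x = par y" "x \<noteq> y"
    have "x \<in> nbrs V d (par x)" "y \<in> nbrs V d (par x)"
      using par(2)[OF xy(1)] par(2)[OF xy(2)] xy(1-3) LV nbrs_sym by blast+
    moreover have "c \<in> nbrs V d (par x)"
      using par(1)[OF xy(1)] nbrs_sym[OF assms(1)] by (simp add: N_def)
    ultimately have "card {c, x, y} \<le> card (nbrs V d (par x))"
      using finite_nbrs by (intro card_mono) auto
    moreover have "c \<noteq> x" "c \<noteq> y" using xy cL by blast+
    then have "card {c, x, y} = 3" using xy(4) by simp
    moreover have "card (nbrs V d (par x)) \<le> 2"
      using assms(3) par(1)[OF xy(1)] unfolding N_def by blast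
    ultimately show False by linarith
  qed
  have adj: "d x y = 1 \<longleftrightarrow> x = c \<and> y \<in> N \<or> y = c \<and> x \<in> N \<or> x \<in> L \<and> y = par x \<or> y \<in> L \<and> x = par y"
    if xy: "x \<in> V" "y \<in> V" for x y
  proof -
    have "d x y = 1 \<longleftrightarrow> y = par x" if "x \<in> L"
      using par(2)[OF that] xy by (auto simp: nbrs_def)
    moreover have "d x y = 1 \<longleftrightarrow> x = par y" if "y \<in> L"
      using par(2)[OF that] xy dist_sym[OF xy] by (auto simp: nbrs_def)
    moreover have "d x y \<noteq> 1" if "x \<in> N" "y \<in> N"
      using nbrs_not_adjacent[OF assms(1)] that by (simp add: N_def)
    moreover have "d x y = 1 \<longleftrightarrow> y \<in> N" if "x = c" using that N1 xy by simp
    moreover have "d x y = 1 \<longleftrightarrow> x \<in> N" if "y = c" using that N1 xy cd by simp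
    moreover have "x = c \<or> x \<in> N \<or> x \<in> L" "y = c \<or> y \<in> N \<or> y \<in> L" using xy V by auto
    moreover have "c \<noteq> par z" if "z \<in> L" for z using that cN par(1) by blast
    ultimately show ?thesis using cN cL NL par(1) by (elim disjE) auto
  qed
  \<comment> \<open>\<open>g\<close> numbers the leg ends and \<open>h0\<close> their neighbours in
    the same order; \<open>h1\<close> then takes the neighbours of \<open>c\<close> without a
    leg.\<close>
  obtain g where g: "bij_betw g {1..k} L"
    using ex_bij_betw_nat_finite_1[OF finL] k_def by blast
  define h0 where "h0 = par \<circ> g"
  have h0: "bij_betw h0 {1..k} (par ` L)"
    unfolding h0_def using g inj_par by (intro bij_betw_trans) (auto simp: bij_betw_def)
  have parLN: "par ` L \<subseteq> N" using par by blast
  have kparL: "card (par ` L) = k" using inj_par by (simp add: card_image k_def)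
  have km: "k \<le> m" unfolding m_def using card_mono[OF finN parLN] kparL by simp
  have "card (N - par ` L) = card {k+1..m}"
    using finN parLN kparL by (simp add: card_Diff_subset finite_subset m_def)
  then obtain h1 where h1: "bij_betw h1 {k+1..m} (N - par ` L)"
    using finite_same_card_bij[of "{k+1..m}" "N - par ` L"] finN by auto
  define h where "h i = (if i \<in> {1..k} then h0 i else h1 i)" for i
  have "bij_betw h ({1..k} \<union> {k+1..m}) (par ` L \<union> (N - par ` L))"
    unfolding h_def by (rule bij_betw_disjoint_Un[OF h0 h1]) auto
  moreover have "{1..k} \<union> {k+1..m} = {1..m}" "par ` L \<union> (N - par ` L) = N"
    using km parLN by auto
  ultimately have h: "bij_betw h {1..m} N" by simp
  have "bij_betw (\<lambda>i. i - m) {m+1..m+k} {1..k}"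
    by (rule bij_betwI[where g = "\<lambda>i. i + m"]) auto
  then have g': "bij_betw (\<lambda>i. g (i - m)) {m+1..m+k} L"
    using bij_betw_trans[OF _ g] by (simp add: comp_def)
  define \<phi> where "\<phi> i = (if i \<in> {0..m} then (if i \<in> {0} then c else h i) else g (i - m))" for i
  have "bij_betw (\<lambda>i. if i \<in> {0} then c else h i) ({0} \<union> {1..m}) ({c} \<union> N)"
    using cN by (intro bij_betw_disjoint_Un[OF _ h]) auto
  moreover have "{0} \<union> {1..m} = {0..m}" by auto
  ultimately have "bij_betw (\<lambda>i. if i \<in> {0} then c else h i) {0..m} ({c} \<union> N)" by simp
  then have "bij_betw \<phi> ({0..m} \<union> {m+1..m+k}) ({c} \<union> N \<union> L)"
    unfolding \<phi>_def using cL NL by (intro bij_betw_disjoint_Un[OF _ g']) auto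
  moreover have "{0..m} \<union> {m+1..m+k} = {..<card V}" using n by auto
  ultimately have bij: "bij_betw \<phi> {..<card V} V" using V by simp
  have \<phi>V: "\<phi> i \<in> V" if "i < card V" for i using bij_betwE[OF bij] that by blast
  have \<phi>_inj: "\<phi> i = \<phi> j \<longleftrightarrow> i = j" if "i < card V" "j < card V" for i j
    using bij that by (auto simp: bij_betw_def inj_on_def)
  have \<phi>_c: "\<phi> i = c \<longleftrightarrow> i = 0" if "i < card V" for i
    using \<phi>_inj[OF that, of 0] n by (simp add: \<phi>_def)
  have \<phi>_N: "\<phi> i \<in> N" if "1 \<le> i" "i \<le> m" for i
    using bij_betwE[OF h] that by (auto simp: \<phi>_def)
  have \<phi>_L: "\<phi> i \<in> L" if "m < i" "i < card V" for i
    using bij_betwE[OF g'] that n by (auto simp: \<phi>_def)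
  have N_iff: "\<phi> i \<in> N \<longleftrightarrow> 1 \<le> i \<and> i \<le> m" if "i < card V" for i
    using \<phi>_N[of i] \<phi>_L[OF _ that] \<phi>_c[OF that] cN NL by (cases "i = 0"; cases "i \<le> m") auto
  have L_iff: "\<phi> i \<in> L \<longleftrightarrow> m < i" if "i < card V" for i
    using \<phi>_N[of i] \<phi>_L[OF _ that] \<phi>_c[OF that] cL NL by (cases "i = 0"; cases "i \<le> m") auto
  \<comment> \<open>The choice \<open>h0 = par \<circ> g\<close> makes the neighbour of the leg end
    \<open>\<phi> i\<close> carry the label \<open>i - m\<close>.\<close>
  have par_iff: "\<phi> j = par (\<phi> i) \<longleftrightarrow> i = m + j" if "i < card V" "j < card V" "m < i" for i j
  proof -
    have im: "i - m \<in> {1..k}" using that n by auto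
    then have "\<phi> (i - m) = par (\<phi> i)" using that km by (auto simp: \<phi>_def h_def h0_def)
    then have "\<phi> j = par (\<phi> i) \<longleftrightarrow> j = i - m" using \<phi>_inj[OF that(2), of "i - m"] that by auto
    then show ?thesis using that(3) by auto
  qed
  show thesis
  proof (rule that[OF bij])
    fix i j assume ij: "i < card V" "j < card V"
    have "d (\<phi> i) (\<phi> j) = 1 \<longleftrightarrow> i = 0 \<and> 1 \<le> j \<and> j \<le> m \<or> j = 0 \<and> 1 \<le> i \<and> i \<le> m \<or>
        m < i \<and> i = m + j \<or> m < j \<and> j = m + i"
      unfolding adj[OF \<phi>V[OF ij(1)] \<phi>V[OF ij(2)]] \<phi>_c[OF ij(1)] \<phi>_c[OF ij(2)]
        N_iff[OF ij(1)] N_iff[OF ij(2)] L_iff[OF ij(1)] L_iff[OF ij(2)]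
      using par_iff[OF ij] par_iff[OF ij(2,1)] by blast
    \<comment> \<open>As labels are below \<open>card V\<close>, the bound
      \<open>i \<le> card V - m - 1\<close> says just that \<open>m + i\<close> is a label.\<close>
    also have "\<dots> \<longleftrightarrow> (i, j) \<in> parcs (spur (card V) m)"
      unfolding parcs_spur using ij n by auto
    finally show "d (\<phi> i) (\<phi> j) = 1 \<longleftrightarrow> (i, j) \<in> parcs (spur (card V) (card (nbrs V d c)))"
      by (simp add: m_def N_def)
  qed
qed

text \<open>\<open>m < n\<close> makes all labels of the star vertices, and
  \<open>n \<le> 2 * m + 1\<close> attaches every label above \<open>m\<close> to a pendent vertex
  of the star.\<close>

lemma spur_imp_spider:
  assumes bij: "bij_betw \<phi> {..<n} V"
    and adj: "\<And>i j. i < n \<Longrightarrow> j < n \<Longrightarrow> d (\<phi> i) (\<phi> j) = 1 \<longleftrightarrow> (i, j) \<in> parcs (spur n m)"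
    and m: "m < n" "n \<le> 2 * m + 1"
  obtains c where "c \<in> V" "card (nbrs V d c) = m" "\<forall>y\<in>V. d c y \<le> 2"
    "\<forall>b\<in>nbrs V d c. card (nbrs V d b) \<le> 2"
proof -
  have VE: "\<exists>j<n. x = \<phi> j" if "x \<in> V" for x
    using bij that by (auto simp: bij_betw_def)
  have \<phi>V: "\<phi> i \<in> V" if "i < n" for i using bij_betwE[OF bij] that by blast
  have nbrs: "nbrs V d (\<phi> i) = \<phi> ` {j. j < n \<and> (i, j) \<in> parcs (spur n m)}" if "i < n" for i
    using VE \<phi>V adj[OF that] by (fastforce simp: nbrs_def)
  define c where "c = \<phi> 0"
  have cV: "c \<in> V" using \<phi>V m by (simp add: c_def)
  have "{j. j < n \<and> (0, j) \<in> parcs (spur n m)} = {1..m}"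
    using m(1) by (auto simp: parcs_spur)
  then have Nc: "nbrs V d c = \<phi> ` {1..m}" using nbrs[of 0] m by (simp add: c_def)
  show thesis
  proof (rule that[OF cV])
    have "inj_on \<phi> {1..m}" using bij m by (auto simp: bij_betw_def intro: inj_on_subset)
    then show "card (nbrs V d c) = m" by (simp add: Nc card_image)
    show "\<forall>b\<in>nbrs V d c. card (nbrs V d b) \<le> 2"
    proof
      fix b assume "b \<in> nbrs V d c"
      then obtain i where i: "b = \<phi> i" "1 \<le> i" "i \<le> m" using Nc by auto
      have "{j. j < n \<and> (i, j) \<in> parcs (spur n m)} \<subseteq> {0, m + i}"
        using i by (auto simp: parcs_spur)
      then have "nbrs V d b \<subseteq> \<phi> ` {0, m + i}"
        using nbrs[of i] i m by auto
      then have "card (nbrs V d b) \<le> card (\<phi> ` {0, m + i})" by (intro card_mono) auto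
      also have "\<dots> \<le> card {0, m + i}" by (rule card_image_le) simp
      also have "\<dots> \<le> 2" using i by simp
      finally show "card (nbrs V d b) \<le> 2" .
    qed
    show "\<forall>y\<in>V. d c y \<le> 2"
    proof
      fix y assume yV: "y \<in> V"
      then obtain j where j: "j < n" "y = \<phi> j" using VE by blast
      consider "j = 0" | "1 \<le> j" "j \<le> m" | "m < j" by linarith
      then show "d c y \<le> 2"
      proof cases
        case 1
        then show ?thesis using j cV dist_self by (simp add: c_def)
      next
        case 2
        then have "y \<in> nbrs V d c" using Nc j by auto
        then show ?thesis by (simp add: nbrs_def)
      next
        case 3
        define i where "i = j - m"
        have i: "1 \<le> i" "i \<le> m" "j = m + i" using 3 j m by (auto simp: i_def)
        have "\<phi> i \<in> nbrs V d c" using Nc i by auto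
        then have "d c (\<phi> i) = 1" "\<phi> i \<in> V" by (auto simp: nbrs_def)
        moreover have "d (\<phi> i) y = 1"
          using adj[of i j] i j by (auto simp: parcs_spur)
        ultimately show ?thesis
          using nbr_dist[of "\<phi> i" c y] cV yV dist_sym[of c "\<phi> i"] dist_sym[of c y] by (auto simp: nbrs_def)
      qed
    qed
  qed
qed

text \<open>A tight bound yields a centre of degree \<open>m\<close> within distance 2 of
  everything, and \<open>degree_nbr_le_2\<close> makes the tree a spider. Conversely a spur is a
  spider, whose index \<open>harary_spider\<close> computes.\<close>

lemma harary_eq_iff:
  assumes "card V \<ge> 2"
  defines "m \<equiv> indep_num V d"
  shows "harary V d = spur_harary (card V) m \<longleftrightarrow>
    (\<exists>\<phi>. bij_betw \<phi> {..<card V} V \<and>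
      (\<forall>i<card V. \<forall>j<card V. d (\<phi> i) (\<phi> j) = 1 \<longleftrightarrow> (i, j) \<in> parcs (spur (card V) m)))"
    (is "?L \<longleftrightarrow> ?R")
proof
  have T: "tree_dist V d" by unfold_locales
  show ?R if ?L
  proof -
    obtain c where c: "c \<in> V" "card (nbrs V d c) = m" "\<forall>y\<in>V. d c y \<le> 2"
      using harary_le[OF T assms(1)] \<open>?L\<close> m_def by blast
    then have "\<forall>b\<in>nbrs V d c. card (nbrs V d b) \<le> 2"
      using degree_nbr_le_2 m_def by blast
    then show ?R using spider_imp_spur[OF c(1,3)] c(2) by metis
  qed
  show ?L if ?R
  proof -
    obtain \<phi> where \<phi>: "bij_betw \<phi> {..<card V} V"
      "\<And>i j. i < card V \<Longrightarrow> j < card V \<Longrightarrow> d (\<phi> i) (\<phi> j) = 1 \<longleftrightarrow> (i, j) \<in> parcs (spur (card V) m)"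
      using \<open>?R\<close> by blast
    \<comment> \<open>The independence number lies in the range where the spur is
      meaningful.\<close>
    have "m < card V" "card V \<le> 2 * m + 1"
      using indep_num_less_card[OF assms(1)] card_le_twice_indep_num by (auto simp: m_def)
    from spur_imp_spider[OF \<phi> this] obtain c where "c \<in> V" "card (nbrs V d c) = m"
      "\<forall>y\<in>V. d c y \<le> 2" "\<forall>b\<in>nbrs V d c. card (nbrs V d b) \<le> 2" by blast
    then show ?L using harary_spider[OF T] by metis
  qed
qed

end

section \<open>Shortest walks in graph-theoretic trees\<close>

context wf_digraph
begin

text \<open>A natural number, as \<open>tree_dist\<close> demands; the value is meaningful once some
  walk from \<open>u\<close> to \<open>v\<close> exists.\<close>

definition walk_dist :: "'a \<Rightarrow> 'a \<Rightarrow> nat" where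
  "walk_dist u v = (LEAST k. \<exists>p. awalk u p v \<and> length p = k)"

lemma walk_dist_le: "awalk u p v \<Longrightarrow> walk_dist u v \<le> length p"
  unfolding walk_dist_def by (rule Least_le) blast

lemma shortest_walkE:
  assumes "u \<rightarrow>\<^sup>* v"
  obtains p where "awalk u p v" "length p = walk_dist u v"
proof -
  have "\<exists>k p. awalk u p v \<and> length p = k" using assms by (auto simp: reachable_awalk)
  then have "\<exists>p. awalk u p v \<and> length p = walk_dist u v" unfolding walk_dist_def by (rule LeastI_ex)
  then show ?thesis using that by blast
qed

text \<open>With unit costs the cost of a walk is its length, and the infimum is attained by a
  shortest walk.\<close>

lemma graph_dist_eq_walk_dist:
  assumes "u \<rightarrow>\<^sup>* v"
  shows "graph_dist G u v = real (walk_dist u v)"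
proof -
  have cost: "awalk_cost (\<lambda>_. 1) p = real (length p)" for p
    by (simp add: awalk_cost_def sum_list_triv)
  obtain p where p: "awalk u p v" "length p = walk_dist u v" using assms by (rule shortest_walkE)
  have "\<mu> (\<lambda>_. 1) u v = ereal (real (walk_dist u v))"
  proof (rule antisym)
    show "\<mu> (\<lambda>_. 1) u v \<le> ereal (real (walk_dist u v))"
      using min_cost_le_walk_cost[OF p(1), of "\<lambda>_. 1"] p(2) by (simp add: cost)
    show "ereal (real (walk_dist u v)) \<le> \<mu> (\<lambda>_. 1) u v"
      unfolding \<mu>_def by (rule INF_greatest) (simp add: cost walk_dist_le)
  qed
  then show ?thesis by (simp add: graph_dist_def)
qed

lemma walk_dist_step:
  assumes "u \<rightarrow> w" "w \<rightarrow>\<^sup>* v"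
  shows "walk_dist u v \<le> Suc (walk_dist w v)"
proof -
  obtain p where p: "awalk w p v" "length p = walk_dist w v" using assms(2) by (rule shortest_walkE)
  obtain e where "e \<in> arcs G" "tail G e = u" "head G e = w" using assms(1) by auto
  then have "awalk u (e # p) v" using p by (simp add: awalk_Cons_iff)
  then show ?thesis using walk_dist_le[of u "e # p" v] p(2) by simp
qed

lemma walk_dist_eq_0:
  assumes "u \<rightarrow>\<^sup>* v"
  shows "walk_dist u v = 0 \<longleftrightarrow> u = v"
proof
  obtain p where "awalk u p v" "length p = walk_dist u v" using assms by (rule shortest_walkE)
  then show "u = v" if "walk_dist u v = 0" using that by (simp add: awalk_Nil_iff)
  show "walk_dist u v = 0" if "u = v"
    using that assms walk_dist_le[of u "[]" u] by (simp add: awalk_Nil_iff reachable_in_verts)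
qed

text \<open>What follows the first arc of a shortest walk is again a shortest walk.\<close>

lemma walk_dist_parentE:
  assumes "u \<rightarrow>\<^sup>* v" "u \<noteq> v"
  obtains w where "u \<rightarrow> w" "w \<rightarrow>\<^sup>* v" "walk_dist u v = Suc (walk_dist w v)"
proof -
  obtain p where p: "awalk u p v" "length p = walk_dist u v" using assms(1) by (rule shortest_walkE)
  then obtain e q where e: "p = e # q" using assms by (cases p) (auto simp: awalk_Nil_iff)
  then have "e \<in> arcs G" "u = tail G e" "awalk (head G e) q v" using p by (auto simp: awalk_Cons_iff)
  then have w: "u \<rightarrow> head G e" "head G e \<rightarrow>\<^sup>* v" "walk_dist (head G e) v \<le> length q"
    by (auto simp: in_arcs_imp_in_arcs_ends reachable_awalk walk_dist_le)
  then have "walk_dist u v = Suc (walk_dist (head G e) v)"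
    using walk_dist_step[OF w(1,2)] p(2) e by simp
  then show ?thesis using that w by blast
qed

lemma walk_dist_adj:
  assumes "u \<rightarrow>\<^sup>* v" "u \<noteq> v"
  shows "walk_dist u v = 1 \<longleftrightarrow> u \<rightarrow> v"
proof
  assume "walk_dist u v = 1"
  moreover obtain w where "u \<rightarrow> w" "w \<rightarrow>\<^sup>* v" "walk_dist u v = Suc (walk_dist w v)"
    using walk_dist_parentE[OF assms] .
  ultimately show "u \<rightarrow> v" using walk_dist_eq_0[of w v] by simp
next
  assume "u \<rightarrow> v"
  then have "v \<rightarrow>\<^sup>* v" using adj_in_verts by blast
  then have "walk_dist u v \<le> 1" using walk_dist_step[OF \<open>u \<rightarrow> v\<close>, of v] walk_dist_eq_0[of v v] by simp
  moreover have "walk_dist u v \<noteq> 0" using walk_dist_eq_0[OF assms(1)] assms(2) by simp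
  ultimately show "walk_dist u v = 1" by simp
qed

end

lemma (in sym_digraph) reverse_awalk:
  "awalk u p v \<Longrightarrow> \<exists>q. awalk v q u \<and> length q = length p"
proof (induction p arbitrary: u)
  case Nil
  then show ?case by (auto simp: awalk_Nil_iff)
next
  case (Cons e p)
  then have e: "e \<in> arcs G" "u = tail G e" "awalk (head G e) p v" by (auto simp: awalk_Cons_iff)
  then obtain q where q: "awalk v q (head G e)" "length q = length p" using Cons.IH by blast
  obtain e' where e': "e' \<in> arcs G" "tail G e' = head G e" "head G e' = tail G e"
    using sym_arcs e(1) unfolding symmetric_conv by metis
  then have "awalk v (q @ [e']) u" using q e arc_implies_awalk[OF e'(1)] by (intro awalk_appendI) auto
  then show ?case using q by (intro exI[of _ "q @ [e']"]) simp
qed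

lemma (in sym_digraph) walk_dist_sym: "walk_dist u v = walk_dist v u"
proof -
  have "(\<exists>p. awalk u p v \<and> length p = k) \<longleftrightarrow> (\<exists>p. awalk v p u \<and> length p = k)" for k
    using reverse_awalk by metis
  then show ?thesis by (simp add: walk_dist_def)
qed

lemma (in pre_digraph) symmetric_del_vert:
  "symmetric G \<Longrightarrow> symmetric (del_vert x)"
  unfolding symmetric_conv del_vert_def by fastforce

section \<open>Acyclicity gives unique parents\<close>

text \<open>Along a shortest walk from \<open>w\<close> the distance to \<open>y\<close> drops at
  every step, so after \<open>w\<close> it is below that of \<open>x\<close> and the walk cannot
  meet \<open>x\<close>.\<close>

lemma (in wf_digraph) geodesic_avoids:
  assumes "y \<rightarrow>\<^sup>* y" "x \<noteq> w" "w \<rightarrow>\<^sup>* y" "walk_dist w y \<le> walk_dist x y"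
  shows "w \<rightarrow>\<^sup>*\<^bsub>del_vert x\<^esub> y"
  using assms(2-4)
proof (induction "walk_dist w y" arbitrary: w)
  case 0
  interpret D: wf_digraph "del_vert x" by (rule wf_digraph_del_vert)
  have "w = y" using 0 walk_dist_eq_0 by simp
  moreover have "w \<in> verts (del_vert x)" using 0 reachable_in_verts by (simp add: verts_del_vert)
  ultimately show ?case by simp
next
  case (Suc k)
  interpret D: wf_digraph "del_vert x" by (rule wf_digraph_del_vert)
  have "w \<noteq> y" using Suc walk_dist_eq_0 by (metis nat.distinct(1))
  then obtain w' where w': "w \<rightarrow> w'" "w' \<rightarrow>\<^sup>* y" "walk_dist w y = Suc (walk_dist w' y)"
    using walk_dist_parentE Suc.prems(2) by blast
  then have "x \<noteq> w'" using Suc.prems(3) by auto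
  then have "w' \<rightarrow>\<^sup>*\<^bsub>del_vert x\<^esub> y" using Suc w' by simp
  moreover have "w \<rightarrow>\<^bsub>del_vert x\<^esub> w'"
    using w'(1) \<open>x \<noteq> w'\<close> Suc.prems(1) by (fastforce simp: arcs_ends_conv del_vert_def)
  ultimately show ?case by (metis D.adj_reachable_trans)
qed

text \<open>The arcs at \<open>x\<close> close up a path from \<open>p\<close> to \<open>z\<close>
  that avoids \<open>x\<close>. The path has an arc because \<open>p \<noteq> z\<close>, which
  excludes going back and forth along one edge.\<close>

lemma (in graph) cycle_through:
  assumes "x \<rightarrow> p" "z \<rightarrow> x" "p \<noteq> z" "p \<rightarrow>\<^sup>*\<^bsub>del_vert x\<^esub> z"
  shows "\<exists>c. cycle c \<and> length c \<ge> 3"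
proof -
  interpret D: wf_digraph "del_vert x" by (rule wf_digraph_del_vert)
  obtain q where "pre_digraph.apath (del_vert x) p q z"
    using assms(4) D.reachable_apath by blast
  then have q: "D.awalk p q z" "distinct (D.awalk_verts p q)" by (auto simp: D.apath_def)
  \<comment> \<open>Deleting a vertex leaves the ends of arcs untouched, so walks of
    \<open>del_vert x\<close> read the same in \<open>G\<close>.\<close>
  have eq: "D.awalk_verts u r = awalk_verts u r" "D.cas u r v = cas u r v" for u r v
    by (induction r arbitrary: u) (simp_all add: D.awalk_verts.simps D.cas.simps del_vert_simps)
  have sub: "set (awalk_verts p q) \<subseteq> verts G - {x}"
    using D.awalk_conv q(1) by (auto simp: eq verts_del_vert)
  have aw: "awalk p q z" 
    using q(1) unfolding D.awalk_def awalk_def eq by (auto simp: del_vert_def)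
  obtain e where e: "e \<in> arcs G" "tail G e = x" "head G e = p" using assms(1) by auto
  obtain f where f: "f \<in> arcs G" "tail G f = z" "head G f = x" using assms(2) by auto
  have "awalk p (q @ [f]) x" using aw f arc_implies_awalk[OF f(1)] by (intro awalk_appendI) auto
  then have "awalk x (e # q @ [f]) x"
    by (rule awalk_ConsI) (simp_all add: e arc_to_ends_def)
  moreover have "awalk_verts p (q @ [f]) = awalk_verts p q @ [x]"
    using awalk_verts_append[OF \<open>awalk p (q @ [f]) x\<close>] f aw by simp
  then have "distinct (tl (awalk_verts x (e # q @ [f])))"
    using q(2) sub e by (auto simp: eq)
  ultimately have "cycle (e # q @ [f])" unfolding cycle_def by blast
  moreover have "q \<noteq> []" using aw assms(3) by (auto simp: awalk_Nil_iff)
  ultimately show ?thesis by (intro exI[of _ "e # q @ [f]"]) (cases q, auto)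
qed

lemma graph_tree_reachable:
  assumes "graph_tree G" "u \<in> verts G" "v \<in> verts G"
  shows "u \<rightarrow>\<^sup>*\<^bsub>G\<^esub> v"
proof -
  interpret graph G using assms by (simp add: graph_tree_def)
  have "strongly_connected G"
    using symmetric_connected_imp_strongly_connected sym_arcs assms by (simp add: graph_tree_def)
  then show ?thesis using assms by (auto simp: strongly_connected_def)
qed

lemma graph_tree_adj:
  assumes "graph_tree G" "u \<in> verts G" "v \<in> verts G"
  shows "wf_digraph.walk_dist G u v = 1 \<longleftrightarrow> u \<rightarrow>\<^bsub>G\<^esub> v"
proof (cases "u = v")
  interpret graph G using assms by (simp add: graph_tree_def)
  case True
  then show ?thesis using walk_dist_eq_0[OF graph_tree_reachable[OF assms]] adj_not_same by auto
next
  interpret graph G using assms by (simp add: graph_tree_def)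
  case False
  then show ?thesis using walk_dist_adj graph_tree_reachable[OF assms] by blast
qed

text \<open>A shortest walk supplies the parent \<open>p\<close>. If another neighbour
  \<open>z\<close> of \<open>x\<close> were not further from \<open>y\<close> than \<open>x\<close>,
  both could reach \<open>y\<close> without \<open>x\<close>, and a cycle through \<open>x\<close>
  would arise.\<close>

lemma graph_tree_tree_dist:
  assumes "graph_tree G"
  shows "tree_dist (verts G) (wf_digraph.walk_dist G)"
proof -
  interpret graph G using assms by (simp add: graph_tree_def)
  have acyc: "\<not> (\<exists>c. cycle c \<and> length c \<ge> 3)" using assms by (simp add: graph_tree_def)
  note R = graph_tree_reachable[OF assms] and adj_iff = graph_tree_adj[OF assms]
  show ?thesis
  proof
    fix x y assume xy: "x \<in> verts G" "y \<in> verts G"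
    show "walk_dist x y = 0 \<longleftrightarrow> x = y" by (rule walk_dist_eq_0[OF R[OF xy]])
    show "walk_dist x y = walk_dist y x" by (rule walk_dist_sym)
  next
    fix x y assume xy: "x \<in> verts G" "y \<in> verts G" "x \<noteq> y"
    obtain p where p: "x \<rightarrow>\<^bsub>G\<^esub> p" "walk_dist x y = Suc (walk_dist p y)"
      using walk_dist_parentE[OF R[OF xy(1,2)] xy(3)] by blast
    then have pV: "p \<in> verts G" using adj_in_verts by blast
    have "walk_dist z y = Suc (walk_dist x y)" if z: "x \<rightarrow>\<^bsub>G\<^esub> z" "z \<noteq> p" for z
    proof (rule ccontr)
      have zV: "z \<in> verts G" using z adj_in_verts by blast
      have zx: "z \<rightarrow>\<^bsub>G\<^esub> x" using sym_arcs z(1) by (rule arcs_ends_symmetric)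
      assume "walk_dist z y \<noteq> Suc (walk_dist x y)"
      then have "walk_dist z y \<le> walk_dist x y"
        using walk_dist_step[OF zx R[OF xy(1,2)]] by simp
      moreover have "x \<noteq> z" "x \<noteq> p" using z(1) p(1) adj_not_same by blast+
      ultimately have "z \<rightarrow>\<^sup>*\<^bsub>del_vert x\<^esub> y" "p \<rightarrow>\<^sup>*\<^bsub>del_vert x\<^esub> y"
        using geodesic_avoids R xy pV zV p(2) by simp_all
      \<comment> \<open>The walk from \<open>z\<close> is reversed and joined to that from
        \<open>p\<close> at \<open>y\<close>.\<close>
      then have "p \<rightarrow>\<^sup>*\<^bsub>del_vert x\<^esub> z"
        by (rule wf_digraph.reachable_trans[OF wf_digraph_del_vert _
            symmetric_reachable[OF symmetric_del_vert[OF sym_arcs]], rotated])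
      then show False using cycle_through[OF p(1) zx z(2)[symmetric]] acyc by blast
    qed
    then show "\<exists>p\<in>verts G. walk_dist x p = 1 \<and> walk_dist x y = Suc (walk_dist p y) \<and>
        (\<forall>z\<in>verts G. walk_dist x z = 1 \<longrightarrow> z \<noteq> p \<longrightarrow> walk_dist z y = Suc (walk_dist x y))"
      using p pV xy(1) adj_iff by blast
  qed simp
qed

section \<open>Isomorphism as a bijection of vertices\<close>

text \<open>Without parallel arcs an arc is determined by its ends, so a bijection of vertices that
  respects adjacency induces the map on arcs.\<close>

lemma digraph_iso_with_proj_iff:
  assumes "nomulti_digraph G" "pair_wf_digraph S"
  shows "digraph_iso G (with_proj S) \<longleftrightarrow>
    (\<exists>f. bij_betw f (verts G) (pverts S) \<and>
      (\<forall>u\<in>verts G. \<forall>v\<in>verts G. u \<rightarrow>\<^bsub>G\<^esub> v \<longleftrightarrow> (f u, f v) \<in> parcs S))" (is "_ \<longleftrightarrow> ?R")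
proof
  interpret nomulti_digraph G by fact
  interpret S: pair_wf_digraph S by fact
  show ?R if iso: "digraph_iso G (with_proj S)"
  proof -
    obtain h where h: "digraph_isomorphism h" "with_proj S = app_iso h G"
      using iso unfolding digraph_iso_def by blast
    have inj: "inj_on (iso_verts h) (verts G)" using h by (simp add: digraph_isomorphism_def)
    have "pverts S = iso_verts h ` verts G"
      using h(2) by (metis with_proj_simps(1) verts_app_iso)
    moreover have ends: "parcs S = (\<lambda>(u,v). (iso_verts h u, iso_verts h v)) ` arcs_ends G"
      using arcs_ends_app_iso_eq[OF h(1)] h(2) by (metis with_proj_simps(3))
    have "u \<rightarrow>\<^bsub>G\<^esub> v \<longleftrightarrow> (iso_verts h u, iso_verts h v) \<in> parcs S" if "u \<in> verts G" "v \<in> verts G" for u v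
    proof
      show "(iso_verts h u, iso_verts h v) \<in> parcs S" if "u \<rightarrow>\<^bsub>G\<^esub> v"
        unfolding ends using that by (rule rev_image_eqI) simp
      assume "(iso_verts h u, iso_verts h v) \<in> parcs S"
      then obtain u' v' where uv: "u' \<rightarrow>\<^bsub>G\<^esub> v'" "iso_verts h u = iso_verts h u'" "iso_verts h v = iso_verts h v'"
        unfolding ends by auto
      then have "u = u'" "v = v'" using adj_in_verts[OF uv(1)] inj_onD[OF inj] that by blast+
      then show "u \<rightarrow>\<^bsub>G\<^esub> v" using uv(1) by simp
    qed
    ultimately show ?R using inj by (auto simp: bij_betw_def)
  qed
  show "digraph_iso G (with_proj S)" if R: ?R
  proof -
    obtain f where f: "bij_betw f (verts G) (pverts S)"
      "\<And>u v. u \<in> verts G \<Longrightarrow> v \<in> verts G \<Longrightarrow> u \<rightarrow>\<^bsub>G\<^esub> v \<longleftrightarrow> (f u, f v) \<in> parcs S"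
      using R by blast
    then have inj: "inj_on f (verts G)" by (simp add: bij_betw_def)
    \<comment> \<open>Arcs of \<open>with_proj S\<close> are pairs, so an arc goes to the pair of
      images of its ends, with \<open>fst\<close> and \<open>snd\<close> as new tail and
      head.\<close>
    define h where "h = \<lparr>iso_verts = f, iso_arcs = \<lambda>e. (f (tail G e), f (head G e)), iso_head = snd, iso_tail = fst\<rparr>"
    have "inj_on (iso_arcs h) (arcs G)"
      using inj no_multi_arcs by (auto simp: h_def inj_on_def arc_to_ends_def)
    then have iso: "digraph_isomorphism h"
      unfolding digraph_isomorphism_def using inj wf_digraph by (simp add: h_def)
    have "iso_arcs h ` arcs G = parcs S"
    proof
      show "iso_arcs h ` arcs G \<subseteq> parcs S"
        using f(2) in_arcs_imp_in_arcs_ends by (auto simp: h_def)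
      show "parcs S \<subseteq> iso_arcs h ` arcs G"
      proof
        fix a assume a: "a \<in> parcs S"
        then have "fst a \<in> f ` verts G" "snd a \<in> f ` verts G"
          using f(1) S.arc_fst_in_verts S.arc_snd_in_verts by (auto simp: bij_betw_def)
        then obtain u v where uv: "a = (f u, f v)" "u \<in> verts G" "v \<in> verts G"
          by (metis imageE prod.collapse)
        then obtain e where "e \<in> arcs G" "tail G e = u" "head G e = v"
          using f(2) a by blast
        then show "a \<in> iso_arcs h ` arcs G" using uv by (auto simp: h_def)
      qed
    qed
    moreover have "f ` verts G = pverts S" using f(1) by (simp add: bij_betw_def)
    ultimately have "with_proj S = app_iso h G"
      by (simp add: with_proj_def app_iso_def h_def)
    then show ?thesis using iso by (auto simp: digraph_iso_def)
  qed
qed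

lemma pair_wf_digraph_spur:
  assumes "m < n"
  shows "pair_wf_digraph (spur n m)"
  using assms by unfold_locales (auto simp: parcs_spur pverts_spur)

text \<open>For a single vertex the bound would be -1/4, below the index 0; hence
  \<open>n \<ge> 2\<close>.\<close>

theorem theorem3p6:
  fixes T :: "('a, 'b) pre_digraph" and n \<alpha> :: nat
  assumes "graph_tree T"
    and "card (verts T) = n"
    and "n \<ge> 2"
    and "independence_number T = \<alpha>"
  shows "harary_index T \<le>
           1 / 24 * (3 * real n ^ 2 + 2 * real \<alpha> * real n + real \<alpha> ^ 2
             - 9 * real \<alpha> + 19 * real n - 22)
       \<and> (harary_index T =
           1 / 24 * (3 * real n ^ 2 + 2 * real \<alpha> * real n + real \<alpha> ^ 2
             - 9 * real \<alpha> + 19 * real n - 22)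
         \<longleftrightarrow> digraph_iso T (with_proj (spur n \<alpha>)))"
proof -
  interpret graph T using assms(1) by (simp add: graph_tree_def)
  interpret tree_dist "verts T" walk_dist using assms(1) by (rule graph_tree_tree_dist)
  have H: "harary_index T = harary (verts T) walk_dist"
    using graph_dist_eq_walk_dist graph_tree_reachable[OF assms(1)]
    by (simp add: harary_index_def harary_def)
  have "independent_set T S \<longleftrightarrow> indep (verts T) walk_dist S" for S
    using graph_tree_adj[OF assms(1)] unfolding independent_set_def indep_def by blast
  then have \<alpha>: "indep_num (verts T) walk_dist = \<alpha>"
    using assms(4) by (simp add: independence_number_def indep_num_def)
  have c2: "card (verts T) \<ge> 2" using assms by simp
  have "\<alpha> < n" using indep_num_less_card[OF c2] \<alpha> assms(2) by simp
  then have "digraph_iso T (with_proj (spur n \<alpha>)) \<longleftrightarrow>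
    (\<exists>f. bij_betw f (verts T) {..<n} \<and>
      (\<forall>u\<in>verts T. \<forall>v\<in>verts T. u \<rightarrow>\<^bsub>T\<^esub> v \<longleftrightarrow> (f u, f v) \<in> parcs (spur n \<alpha>)))"
    using digraph_iso_with_proj_iff[OF nomulti_digraph pair_wf_digraph_spur] by (simp add: pverts_spur)
  \<comment> \<open>An isomorphism maps \<open>T\<close> to the spur, while
    \<open>harary_eq_iff\<close> labels the vertices of \<open>T\<close> by numbers; the two maps
    are inverse to each other.\<close>
  also have "\<dots> \<longleftrightarrow> (\<exists>\<phi>. bij_betw \<phi> {..<n} (verts T) \<and>
      (\<forall>i<n. \<forall>j<n. walk_dist (\<phi> i) (\<phi> j) = 1 \<longleftrightarrow> (i, j) \<in> parcs (spur n \<alpha>)))" (is "?L \<longleftrightarrow> ?R")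
  proof
    assume ?L
    then obtain f where f: "bij_betw f (verts T) {..<n}"
      "\<forall>u\<in>verts T. \<forall>v\<in>verts T. u \<rightarrow>\<^bsub>T\<^esub> v \<longleftrightarrow> (f u, f v) \<in> parcs (spur n \<alpha>)" by blast
    define \<phi> where "\<phi> = inv_into (verts T) f"
    have \<phi>: "bij_betw \<phi> {..<n} (verts T)" unfolding \<phi>_def by (rule bij_betw_inv_into[OF f(1)])
    have V: "\<phi> i \<in> verts T" "f (\<phi> i) = i" if "i < n" for i
      using bij_betwE[OF \<phi>] bij_betw_inv_into_right[OF f(1)] that by (auto simp: \<phi>_def)
    have "walk_dist (\<phi> i) (\<phi> j) = 1 \<longleftrightarrow> (i, j) \<in> parcs (spur n \<alpha>)" if "i < n" "j < n" for i j
      using graph_tree_adj[OF assms(1) V(1)[OF that(1)] V(1)[OF that(2)]] f(2) V that by metis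
    then show ?R using \<phi> by blast
  next
    assume ?R
    then obtain \<phi> where \<phi>: "bij_betw \<phi> {..<n} (verts T)"
      "\<forall>i<n. \<forall>j<n. walk_dist (\<phi> i) (\<phi> j) = 1 \<longleftrightarrow> (i, j) \<in> parcs (spur n \<alpha>)" by blast
    define f where "f = inv_into {..<n} \<phi>"
    have f: "bij_betw f (verts T) {..<n}" unfolding f_def by (rule bij_betw_inv_into[OF \<phi>(1)])
    have V: "f u < n" "\<phi> (f u) = u" if "u \<in> verts T" for u
      using bij_betwE[OF f] bij_betw_inv_into_right[OF \<phi>(1)] that by (auto simp: f_def)
    have "u \<rightarrow>\<^bsub>T\<^esub> v \<longleftrightarrow> (f u, f v) \<in> parcs (spur n \<alpha>)" if "u \<in> verts T" "v \<in> verts T" for u v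
      using graph_tree_adj[OF assms(1) that] \<phi>(2) V that by metis
    then show ?L using f by blast
  qed
  also have "\<dots> \<longleftrightarrow> harary (verts T) walk_dist = spur_harary n \<alpha>"
    using harary_eq_iff[OF c2] unfolding \<alpha> assms(2) by blast
  finally have "digraph_iso T (with_proj (spur n \<alpha>)) \<longleftrightarrow> harary_index T = spur_harary n \<alpha>"
    unfolding H .
  moreover have "harary_index T \<le> spur_harary n \<alpha>"
    using harary_le[OF graph_tree_tree_dist[OF assms(1)] c2] unfolding H \<alpha> assms(2) by blast
  ultimately show ?thesis unfolding spur_harary_def by blast
qed

end
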